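(* Let $Q$ be a connected finite acyclic quiver with vertices $1,\dots,n$ labelled as in the context, and let $X(Q)$ be its frieze variety. If $a_\ast\in\mathbb{C}^n$ is a generic point on $X(Q)$, then $a_\ast$ is a generic specialization and $X(Q,a_\ast)=\widetilde X(Q)$. More precisely: for each irreducible component $X_i$ of $X(Q)$ of dimension $\ge 1$ there is a subset $U_i\subset X_i$, given as a countable intersection $U_i=\bigcap_{d\ge 1}U_i^d$ of dense Zariski-open subsets $U_i^d$ of $X_i$, such that every $a_\ast$ in any of the sets $U_i$ is a generic specialization and satisfies $X(Q,a_\ast)=\widetilde X(Q)$.
   Context: $Q$ is a connected finite quiver without oriented cycles (multiple arrows allowed), with vertices labelled $1,\dots,n$ so that if there is an arrow $i\to j$ then $i>j$. Coxeter mutation: for $a_\ast=(a_1,\dots,a_n)\in(\mathbb{C}^\times)^n$ put $\mu_\ast(a_\ast)=(a_1',\dots,a_n')\in\mathbb{C}^n$, where recursively for $k=1,\dots,n$ $$a_k'=\frac{1+\prod_{j\to k}a_j\prod_{k\to j}a_j'}{a_k},$$ the products running over all arrows of $Q$ ending at $k$, respectively starting at $k$, counted with multiplicity. (This is the specialization at $x_i=a_i$ of the cluster obtained from the initial cluster $\mathbf{x}=(x_1,\dots,x_n)$ of the cluster algebra of $Q$ by the mutation sequence $\mu_n\circ\cdots\circ\mu_2\circ\mu_1$.) $\mu_\ast^t$ denotes the $t$-fold iterate. A point $a_\ast\in\mathbb{C}^n$ is a generic specialization (of $\mathbf{x}$) if all coordinates of $\mu_\ast^t(a_\ast)$ are nonzero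 for all $t\ge 0$. The $\mu_\ast$-orbit of $a_\ast$ is $\{\mu_\ast^t(a_\ast):t\ge 0\}$. For a generic specialization $a_\ast$, the generalized frieze variety $X(Q,a_\ast)$ is the Zariski closure in $\mathbb{C}^n$ of the $\mu_\ast$-orbit of $a_\ast$, and $\widetilde X(Q,a_\ast)$ is $X(Q,a_\ast)$ with its zero-dimensional irreducible components removed. The frieze variety is $X(Q)=X(Q,(1,\dots,1))$, and $\widetilde X(Q)=\widetilde X(Q,(1,\dots,1))$. *)

theory Defs
  imports
    "HOL-Analysis.Abstract_Topology"
    "HOL-Library.Poly_Mapping"
    "HOL-Library.Extended_Nat"
    "Graph_Theory.Graph_Theory"
begin

section \<open>Irreducible components and Krull dimension of a topological space\<close>

definition irreducible_space :: "'a topology \<Rightarrow> bool" where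
  "irreducible_space T \<longleftrightarrow> topspace T \<noteq> {} \<and>
     (\<forall>A B. closedin T A \<longrightarrow> closedin T B \<longrightarrow> topspace T = A \<union> B \<longrightarrow>
        A = topspace T \<or> B = topspace T)"

definition irreducible_in :: "'a topology \<Rightarrow> 'a set \<Rightarrow> bool" where
  "irreducible_in T S \<longleftrightarrow> S \<subseteq> topspace T \<and> irreducible_space (subtopology T S)"

definition irreducible_components :: "'a topology \<Rightarrow> 'a set set" where
  "irreducible_components T =
     {C. irreducible_in T C \<and> (\<forall>D. irreducible_in T D \<longrightarrow> C \<subseteq> D \<longrightarrow> D = C)}"

text \<open>Supremum of the lengths of strict chains \<open>Z 0 \<subset> Z 1 \<subset> \<dots> \<subset> Z d\<close> of irreducible closed
  subsets. The dimension of the empty space comes out as 0 here, but irreducible spaces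
  are nonempty.\<close>

definition krull_dim :: "'a topology \<Rightarrow> enat" where
  "krull_dim T = Sup {enat d | d. \<exists>Z :: nat \<Rightarrow> 'a set.
     (\<forall>i\<le>d. closedin T (Z i) \<and> irreducible_in T (Z i)) \<and> (\<forall>i<d. Z i \<subset> Z (Suc i))}"


section \<open>The Zariski topology on affine space\<close>

text \<open>A point of the affine space over \<open>\<complex>\<close> with coordinates indexed by \<open>V\<close> is an extensional
  function: it takes the value \<open>undefined\<close> outside \<open>V\<close>.\<close>

abbreviation affine_space :: "'v set \<Rightarrow> ('v \<Rightarrow> complex) set" where
  "affine_space V \<equiv> (\<Pi>\<^sub>E v\<in>V. UNIV)"

text \<open>A polynomial maps exponent vectors to coefficients.\<close>

type_synonym 'v cpoly = "('v \<Rightarrow>\<^sub>0 nat) \<Rightarrow>\<^sub>0 complex"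

definition polys :: "'v set \<Rightarrow> 'v cpoly set" where
  "polys V = {p. \<forall>m\<in>Poly_Mapping.keys p. Poly_Mapping.keys m \<subseteq> V}"

definition mon_eval :: "('v \<Rightarrow>\<^sub>0 nat) \<Rightarrow> ('v \<Rightarrow> complex) \<Rightarrow> complex" where
  "mon_eval m a = (\<Prod>v\<in>Poly_Mapping.keys m. a v ^ Poly_Mapping.lookup m v)"

definition poly_eval :: "'v cpoly \<Rightarrow> ('v \<Rightarrow> complex) \<Rightarrow> complex" where
  "poly_eval p a = (\<Sum>m\<in>Poly_Mapping.keys p. Poly_Mapping.lookup p m * mon_eval m a)"

definition zero_set :: "'v set \<Rightarrow> 'v cpoly set \<Rightarrow> ('v \<Rightarrow> complex) set" where
  "zero_set V P = {a \<in> affine_space V. \<forall>p\<in>P. poly_eval p a = 0}"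

definition zariski :: "'v set \<Rightarrow> ('v \<Rightarrow> complex) topology" where
  "zariski V = topology (\<lambda>U. \<exists>P\<subseteq>polys V. U = affine_space V - zero_set V P)"

lemma mon_eval_superset:
  assumes "finite A" "Poly_Mapping.keys m \<subseteq> A"
  shows "mon_eval m a = (\<Prod>v\<in>A. a v ^ Poly_Mapping.lookup m v)"
  unfolding mon_eval_def
  using assms by (intro prod.mono_neutral_left) (auto simp: in_keys_iff)

lemma mon_eval_add: "mon_eval (m + m') a = mon_eval m a * mon_eval m' a"
proof -
  let ?A = "Poly_Mapping.keys m \<union> Poly_Mapping.keys m'"
  have "mon_eval (m + m') a = (\<Prod>v\<in>?A. a v ^ Poly_Mapping.lookup (m + m') v)"
    by (rule mon_eval_superset) (use Poly_Mapping.keys_add[of m m'] in auto)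
  then show ?thesis
    by (simp add: mon_eval_superset[of ?A m] mon_eval_superset[of ?A m']
        lookup_add power_add prod.distrib)
qed

lemma poly_eval_superset:
  assumes "finite A" "Poly_Mapping.keys p \<subseteq> A"
  shows "poly_eval p a = (\<Sum>m\<in>A. Poly_Mapping.lookup p m * mon_eval m a)"
  unfolding poly_eval_def
  using assms by (intro sum.mono_neutral_left) (auto simp: in_keys_iff)

lemma poly_eval_add: "poly_eval (p + q) a = poly_eval p a + poly_eval q a"
proof -
  let ?A = "Poly_Mapping.keys p \<union> Poly_Mapping.keys q"
  have "poly_eval (p + q) a = (\<Sum>m\<in>?A. Poly_Mapping.lookup (p + q) m * mon_eval m a)"
    by (rule poly_eval_superset) (use Poly_Mapping.keys_add[of p q] in auto)
  then show ?thesis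
    by (simp add: poly_eval_superset[of ?A p] poly_eval_superset[of ?A q]
        lookup_add distrib_right sum.distrib)
qed

lemma poly_eval_0 [simp]: "poly_eval 0 a = 0"
  by (simp add: poly_eval_def)

lemma poly_eval_single [simp]: "poly_eval (Poly_Mapping.single m c) a = c * mon_eval m a"
  by (cases "c = 0") (simp_all add: poly_eval_def)

lemma poly_eval_1 [simp]: "poly_eval 1 a = 1"
  unfolding single_one[symmetric] poly_eval_single by (simp add: mon_eval_def)

lemma poly_eval_sum: "poly_eval (sum f A) a = (\<Sum>x\<in>A. poly_eval (f x) a)"
  by (induction A rule: infinite_finite_induct) (simp_all add: poly_eval_add)

lemma sum_single_lookup:
  "(\<Sum>m\<in>Poly_Mapping.keys p. Poly_Mapping.single m (Poly_Mapping.lookup p m)) = p"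
  by (rule poly_mapping_eqI)
    (simp add: lookup_sum lookup_single when_def sum.delta in_keys_iff)

lemma poly_eval_mult: "poly_eval (p * q) a = poly_eval p a * poly_eval q a"
proof -
  let ?s = "\<lambda>p m. Poly_Mapping.single m (Poly_Mapping.lookup p m)"
  have "p * q = (\<Sum>m\<in>Poly_Mapping.keys p. ?s p m) * (\<Sum>m'\<in>Poly_Mapping.keys q. ?s q m')"
    by (simp only: sum_single_lookup)
  then have "poly_eval (p * q) a =
      poly_eval ((\<Sum>m\<in>Poly_Mapping.keys p. ?s p m) * (\<Sum>m'\<in>Poly_Mapping.keys q. ?s q m')) a"
    by (rule arg_cong)
  also have "\<dots> = (\<Sum>m\<in>Poly_Mapping.keys p. \<Sum>m'\<in>Poly_Mapping.keys q.
      (Poly_Mapping.lookup p m * mon_eval m a) * (Poly_Mapping.lookup q m' * mon_eval m' a))"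
    by (simp add: sum_product poly_eval_sum mult_single mon_eval_add mult_ac)
  also have "\<dots> = poly_eval p a * poly_eval q a"
    unfolding poly_eval_def by (rule sum_product[symmetric])
  finally show ?thesis .
qed

lemma polys_mult: "p \<in> polys V \<Longrightarrow> q \<in> polys V \<Longrightarrow> p * q \<in> polys V"
  unfolding polys_def
proof (intro CollectI ballI)
  fix m
  assume p: "p \<in> {p. \<forall>m\<in>Poly_Mapping.keys p. Poly_Mapping.keys m \<subseteq> V}"
    and q: "q \<in> {p. \<forall>m\<in>Poly_Mapping.keys p. Poly_Mapping.keys m \<subseteq> V}"
    and m: "m \<in> Poly_Mapping.keys (p * q)"
  obtain b c where "b \<in> Poly_Mapping.keys p" "c \<in> Poly_Mapping.keys q" "m = b + c"
    using subsetD[OF Poly_Mapping.keys_mult m] by blast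
  then show "Poly_Mapping.keys m \<subseteq> V"
    using p q Poly_Mapping.keys_add[of b c] by blast
qed

lemma istopology_zariski:
  "istopology (\<lambda>U. \<exists>P\<subseteq>polys V. U = affine_space V - zero_set V P)" (is "istopology ?open")
  unfolding istopology_def
proof (intro conjI allI impI)
  fix S T assume "?open S" "?open T"
  then obtain P R where P: "P \<subseteq> polys V" "S = affine_space V - zero_set V P"
    and R: "R \<subseteq> polys V" "T = affine_space V - zero_set V R" by auto
  let ?M = "{p * r | p r. p \<in> P \<and> r \<in> R}"
  have "?M \<subseteq> polys V" using P(1) R(1) polys_mult by blast
  moreover have "zero_set V ?M = zero_set V P \<union> zero_set V R"
  proof (intro set_eqI iffI)
    fix a assume a: "a \<in> zero_set V ?M"
    have "poly_eval p a = 0 \<or> poly_eval r a = 0" if "p \<in> P" "r \<in> R" for p r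
    proof -
      have "poly_eval (p * r) a = 0" using a that unfolding zero_set_def by blast
      then show ?thesis by (simp add: poly_eval_mult)
    qed
    with a show "a \<in> zero_set V P \<union> zero_set V R" unfolding zero_set_def by blast
  next
    fix a assume "a \<in> zero_set V P \<union> zero_set V R"
    then show "a \<in> zero_set V ?M" unfolding zero_set_def by (auto simp: poly_eval_mult)
  qed
  then have "S \<inter> T = affine_space V - zero_set V ?M" using P(2) R(2) by blast
  ultimately show "?open (S \<inter> T)" by blast
next
  fix K assume "\<forall>S\<in>K. ?open S"
  then have "\<exists>F. \<forall>S\<in>K. F S \<subseteq> polys V \<and> S = affine_space V - zero_set V (F S)"
    by (rule bchoice)
  then obtain F where F: "\<forall>S\<in>K. F S \<subseteq> polys V \<and> S = affine_space V - zero_set V (F S)" ..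
  have "\<Union>K = affine_space V - zero_set V (\<Union>(F ` K))"
  proof -
    have "(\<lambda>S. affine_space V - zero_set V (F S)) ` K = (\<lambda>S. S) ` K"
      by (rule image_cong) (use F in simp_all)
    then have "\<Union>K = (\<Union>S\<in>K. affine_space V - zero_set V (F S))" by simp
    also have "\<dots> = affine_space V - zero_set V (\<Union>(F ` K))"
      unfolding zero_set_def by blast
    finally show ?thesis .
  qed
  moreover have "\<Union>(F ` K) \<subseteq> polys V"
    using F by (simp add: UN_subset_iff)
  ultimately show "?open (\<Union>K)" by blast
qed

lemma openin_zariski:
  "openin (zariski V) U \<longleftrightarrow> (\<exists>P\<subseteq>polys V. U = affine_space V - zero_set V P)"
  by (simp add: zariski_def topology_inverse'[OF istopology_zariski])

lemma topspace_zariski [simp]: "topspace (zariski V) = affine_space V"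
proof (rule subset_antisym)
  show "topspace (zariski V) \<subseteq> affine_space V"
    using openin_topspace[of "zariski V"] unfolding openin_zariski by blast
  have "affine_space V = affine_space V - zero_set V {1}" by (simp add: zero_set_def)
  moreover have "{1} \<subseteq> polys V" by (simp add: polys_def)
  ultimately have "openin (zariski V) (affine_space V)"
    unfolding openin_zariski by blast
  then show "affine_space V \<subseteq> topspace (zariski V)" by (rule openin_subset)
qed

lemma closedin_zariski: "closedin (zariski V) S \<longleftrightarrow> (\<exists>P\<subseteq>polys V. S = zero_set V P)"
proof -
  have sub: "zero_set V P \<subseteq> affine_space V" for P unfolding zero_set_def by blast
  have eq: "S = zero_set V P \<longleftrightarrow>
      S \<subseteq> affine_space V \<and> affine_space V - S = affine_space V - zero_set V P" for P
    using sub[of P] by blast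
  show ?thesis
    unfolding eq closedin_def openin_zariski topspace_zariski by blast
qed


section \<open>Coxeter mutation and generalized frieze varieties\<close>

text \<open>A quiver is a \<^typ>\<open>('v, 'e) pre_digraph\<close>; an arrow \<open>e : i \<rightarrow> j\<close> has \<open>tail Q e = i\<close> and
  \<open>head Q e = j\<close>, so products over sets of arrows count multiplicities. If arrows point from
  larger to smaller labels, the condition \<open>head Q e < k\<close> is vacuous, and only serves to make
  the recursion well-founded for arbitrary \<open>Q\<close>; see \<open>coxeter_coord_labelled\<close>.\<close>

function coxeter_coord :: "(nat, 'e) pre_digraph \<Rightarrow> (nat \<Rightarrow> complex) \<Rightarrow> nat \<Rightarrow> complex" where
  "coxeter_coord Q a k =
     (1 + (\<Prod>e\<in>in_arcs Q k. a (tail Q e)) *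
          (\<Prod>e\<in>{e \<in> out_arcs Q k. head Q e < k}. coxeter_coord Q a (head Q e))) / a k"
  by pat_completeness auto
termination by (relation "measure (\<lambda>(Q, a, k). k)") auto

declare coxeter_coord.simps [simp del]

lemma coxeter_coord_labelled:
  assumes "\<forall>e\<in>arcs Q. head Q e < tail Q e"
  shows "coxeter_coord Q a k =
     (1 + (\<Prod>e\<in>in_arcs Q k. a (tail Q e)) *
          (\<Prod>e\<in>out_arcs Q k. coxeter_coord Q a (head Q e))) / a k"
proof -
  have "{e \<in> out_arcs Q k. head Q e < k} = out_arcs Q k"
    using assms by (auto simp: out_arcs_def)
  then show ?thesis by (subst coxeter_coord.simps) simp
qed

definition coxeter_mutation ::
    "(nat, 'e) pre_digraph \<Rightarrow> (nat \<Rightarrow> complex) \<Rightarrow> (nat \<Rightarrow> complex)" where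
  "coxeter_mutation Q a = (\<lambda>k\<in>verts Q. coxeter_coord Q a k)"

text \<open>Division is total (\<open>x / 0 = 0\<close>), so all iterates below exist; but along the orbit of a
  generic specialization no division by zero takes place.\<close>

definition generic_specialization :: "(nat, 'e) pre_digraph \<Rightarrow> (nat \<Rightarrow> complex) \<Rightarrow> bool" where
  "generic_specialization Q a \<longleftrightarrow> a \<in> affine_space (verts Q) \<and>
     (\<forall>t. \<forall>k\<in>verts Q. (coxeter_mutation Q ^^ t) a k \<noteq> 0)"

definition coxeter_orbit :: "(nat, 'e) pre_digraph \<Rightarrow> (nat \<Rightarrow> complex) \<Rightarrow> (nat \<Rightarrow> complex) set" where
  "coxeter_orbit Q a = {(coxeter_mutation Q ^^ t) a | t. True}"

definition gen_frieze_variety ::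
    "(nat, 'e) pre_digraph \<Rightarrow> (nat \<Rightarrow> complex) \<Rightarrow> (nat \<Rightarrow> complex) set" where
  "gen_frieze_variety Q a = zariski (verts Q) closure_of coxeter_orbit Q a"

definition frieze_variety :: "(nat, 'e) pre_digraph \<Rightarrow> (nat \<Rightarrow> complex) set" where
  "frieze_variety Q = gen_frieze_variety Q (\<lambda>k\<in>verts Q. 1)"

definition remove_zero_dim_components ::
    "'v set \<Rightarrow> ('v \<Rightarrow> complex) set \<Rightarrow> ('v \<Rightarrow> complex) set" where
  "remove_zero_dim_components V X =
     X - \<Union>{C \<in> irreducible_components (subtopology (zariski V) X).
             krull_dim (subtopology (zariski V) C) = 0}"

definition frieze_variety_tilde :: "(nat, 'e) pre_digraph \<Rightarrow> (nat \<Rightarrow> complex) set" where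
  "frieze_variety_tilde Q = remove_zero_dim_components (verts Q) (frieze_variety Q)"

definition dense_open_in :: "'a topology \<Rightarrow> 'a set \<Rightarrow> bool" where
  "dense_open_in T U \<longleftrightarrow> openin T U \<and> T closure_of U = topspace T"

end

theory Submission
  imports Defs
begin

text \<open>Let \<open>x\<^sub>t\<close> be the \<open>t\<close>-th Coxeter iterate of the point with all coordinates 1, and
  let \<open>X\<close> be the Zariski closure of \<open>{x\<^sub>0, x\<^sub>1, \<dots>}\<close>. A component of positive dimension can only exist
  if the points \<open>x\<^sub>t\<close> are pairwise distinct, because a repetition makes the orbit finite. By Hilbert's
  basis theorem, affine space is a Noetherian space (\<open>noetherian_zariski\<close>), so the closures of
  the tails \<open>{x\<^sub>t | t \<ge> N}\<close> decrease to a set \<open>Z\<close> that is reached for some \<open>N\<close>. This \<open>Z\<close> is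
  \<open>X\<close> without its zero-dimensional components
  (\<open>tail_closure_eq_nonpoint_components\<close>): a point component lying in \<open>Z\<close> would meet every late
  tail, whereas a point is visited at most once. In particular \<open>Z\<close> is the closure of the orbit of
  every late \<open>x\<^sub>s\<close>, and each component \<open>C\<close> of positive dimension contains such an \<open>x\<^sub>s\<close>
  (\<open>component_meets_dense\<close>).

  It remains to compare a point \<open>a\<close> of \<open>C\<close> with \<open>b = x\<^sub>s\<close>. Coordinates of Coxeter iterates
  are rational functions that are defined wherever the earlier iterates have nonzero
  coordinates, and all iterates of \<open>b\<close> have nonzero coordinates because they are positive reals.
  \<^item> For each \<open>t\<close>, the coordinates of the \<open>t\<close>-th iterate are nonzero on a Zariski-neighbourhood of \<open>b\<close>.
  \<^item> If all of these conditions hold at \<open>a\<close>, then the orbit of \<open>a\<close> stays in \<open>Z\<close> by continuity,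
    since the iterates map a late tail into a late tail (\<open>coxeter_iterate_tail_closure\<close>).
  \<^item> For each \<open>d\<close>, choose monomials with exponents at most \<open>d\<close> that restrict to a basis of the
    space of functions on \<open>Z\<close> spanned by all such monomials. They are linearly independent along
    the orbit of \<open>b\<close>, which is dense in \<open>Z\<close>. Linear independence of finitely many sequences of
    rational functions persists on a neighbourhood of \<open>b\<close> (\<open>lin_indep_nearby\<close>). Hence for \<open>a\<close> in
    that neighbourhood with orbit in \<open>Z\<close>, a polynomial with exponents at most \<open>d\<close> that vanishes on
    the orbit of \<open>a\<close> vanishes on \<open>Z\<close> (\<open>nearby_orbits_separate_polys\<close>).

  These are countably many neighbourhoods of the single point \<open>b\<close>, and each of them meets the irreducible
  set \<open>C\<close> in a dense open subset. For \<open>a\<close> in their intersection with \<open>C\<close>, the polynomials that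
  vanish on the orbit of \<open>a\<close> are exactly those that vanish on \<open>Z\<close>, so the orbit closure is \<open>Z\<close>.\<close>


section \<open>Polynomial functions on affine space\<close>

lemma polys_const: "Poly_Mapping.single 0 c \<in> polys V"
  by (simp add: polys_def)

lemma polys_single: "Poly_Mapping.keys m \<subseteq> V \<Longrightarrow> Poly_Mapping.single m c \<in> polys V"
  by (simp add: polys_def)

lemma polys_add: "p \<in> polys V \<Longrightarrow> q \<in> polys V \<Longrightarrow> p + q \<in> polys V"
  unfolding polys_def using Poly_Mapping.keys_add[of p q] by blast

lemma polys_sum: "(\<And>x. x \<in> A \<Longrightarrow> f x \<in> polys V) \<Longrightarrow> sum f A \<in> polys V"
  by (induction A rule: infinite_finite_induct) (auto intro: polys_add simp: polys_const[of 0, simplified])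

lemma polys_diff: "p \<in> polys V \<Longrightarrow> q \<in> polys V \<Longrightarrow> p - q \<in> polys V"
  unfolding polys_def using Poly_Mapping.keys_diff[of p q] by blast

lemma poly_eval_diff: "poly_eval (p - q) a = poly_eval p a - poly_eval q a"
  using poly_eval_add[of "p - q" q a] by (simp add: algebra_simps)

lemma poly_eval_const: "poly_eval (Poly_Mapping.single 0 c) a = c"
  by (simp add: mon_eval_def)

lemma poly_eval_var: "poly_eval (Poly_Mapping.single (Poly_Mapping.single v (Suc 0)) 1) a = a v"
  by (simp add: mon_eval_def)

section \<open>Dickson's lemma and Hilbert's basis theorem\<close>

lemma nat_incseq_subseq:
  fixes s :: "nat \<Rightarrow> nat"
  obtains f where "strict_mono f" "incseq (s \<circ> f)"
proof -
  obtain f where f: "strict_mono f" "monoseq (\<lambda>n. s (f n))"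
    using seq_monosub by blast
  show thesis
  proof (cases "incseq (\<lambda>n. s (f n))")
    case True
    then show ?thesis using f that by (simp add: comp_def)
  next
    case False
    then have dec: "decseq (\<lambda>n. s (f n))" using f(2) by (simp add: monoseq_iff)
    obtain N where N: "\<And>n. s (f N) \<le> s (f n)"
      using ex_has_least_nat[of "\<lambda>_. True" _ "\<lambda>n. s (f n)"] by blast
    have const: "s (f (N + n)) = s (f N)" for n
      using N[of "N + n"] dec by (simp add: decseq_def antisym)
    have "strict_mono (\<lambda>n. f (N + n))" using f(1) by (simp add: strict_mono_def)
    then show ?thesis by (rule that) (simp add: const incseq_def)
  qed
qed

lemma dickson_subseq:
  fixes m :: "nat \<Rightarrow> 'v \<Rightarrow>\<^sub>0 nat"
  assumes "finite V"
  shows "\<exists>r. strict_mono r \<and> (\<forall>v\<in>V. incseq (\<lambda>i. Poly_Mapping.lookup (m (r i)) v))"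
  using assms
proof (induction V rule: finite_induct)
  case empty
  show ?case by (rule exI[of _ id]) (simp add: strict_mono_def)
next
  case (insert x V)
  then obtain r where r: "strict_mono r" "\<forall>v\<in>V. incseq (\<lambda>i. Poly_Mapping.lookup (m (r i)) v)"
    by blast
  obtain f where f: "strict_mono f" "incseq ((\<lambda>i. Poly_Mapping.lookup (m (r i)) x) \<circ> f)"
    by (rule nat_incseq_subseq)
  have "incseq (\<lambda>i. Poly_Mapping.lookup (m (r (f i))) v)" if "v \<in> V" for v
    using r(2) that strict_mono_mono[OF f(1)] unfolding incseq_def mono_def by blast
  then show ?case
    using f strict_mono_o[OF r(1) f(1)] by (intro exI[of _ "r \<circ> f"]) (auto simp: comp_def)
qed

text \<open>Along the subsequence of \<open>dickson_subseq\<close> every exponent is nondecreasing, so already its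
  first term divides its second.\<close>

lemma dickson:
  fixes m :: "nat \<Rightarrow> 'v \<Rightarrow>\<^sub>0 nat"
  assumes "finite V" "\<And>i. Poly_Mapping.keys (m i) \<subseteq> V"
  obtains i j u where "i < j" "m j = m i + u"
proof -
  obtain r where r: "strict_mono r" "\<forall>v\<in>V. incseq (\<lambda>i. Poly_Mapping.lookup (m (r i)) v)"
    using dickson_subseq[OF assms(1)] by blast
  have le: "Poly_Mapping.lookup (m (r 0)) v \<le> Poly_Mapping.lookup (m (r 1)) v" for v
  proof (cases "v \<in> V")
    case True
    then have "incseq (\<lambda>i. Poly_Mapping.lookup (m (r i)) v)" using r(2) by blast
    from incseqD[OF this, of 0 1] show ?thesis by simp
  next
    case False
    then have "v \<notin> Poly_Mapping.keys (m (r 0))" using assms(2) by blast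
    then show ?thesis by (simp add: in_keys_iff)
  qed
  have "m (r 1) = m (r 0) + (m (r 1) - m (r 0))"
    by (rule poly_mapping_eqI) (use le in \<open>simp add: lookup_add lookup_minus\<close>)
  moreover have "r 0 < r 1" using r(1) by (simp add: strict_mono_def)
  ultimately show thesis using that by blast
qed

lemma mon_zero_le:
  fixes u :: "'v::linorder \<Rightarrow>\<^sub>0 nat"
  shows "0 \<le> u"
proof (rule ccontr)
  assume "\<not> 0 \<le> u"
  then have "u < 0" by simp
  then show False by transfer (auto simp: less_fun_def)
qed

text \<open>Monomials are compared by the lexicographic order on exponent vectors. In infinitely many variables
  it is not well-founded; with a finite set of variables, an infinite descent would
  contain, by Dickson's lemma, a monomial followed by one of its multiples, which cannot be smaller.\<close>

lemma wf_mon: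
  assumes "finite (V :: 'v::linorder set)"
  shows "wf {(m, m' :: 'v \<Rightarrow>\<^sub>0 nat). m < m' \<and> Poly_Mapping.keys m \<subseteq> V \<and> Poly_Mapping.keys m' \<subseteq> V}"
    (is "wf ?R")
proof (rule ccontr)
  assume "\<not> wf ?R"
  then obtain m where m: "\<And>i. (m (Suc i), m i) \<in> ?R"
    unfolding wf_iff_no_infinite_down_chain by blast
  have "m j < m i" if "i < j" for i j
    using that by (induction rule: less_Suc_induct) (use m in \<open>auto intro: less_trans\<close>)
  moreover obtain i j u where "i < j" "m j = m i + u"
    using dickson[OF assms, of m] m by blast
  moreover have "m i \<le> m i + u"
    using add_left_mono[OF mon_zero_le, of "m i" u] by simp
  ultimately show False by (metis leD)
qed

text \<open>Only meaningful for nonzero polynomials, as the maximum of the empty set is unspecified.\<close>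

definition lead_mon :: "'v::linorder cpoly \<Rightarrow> 'v \<Rightarrow>\<^sub>0 nat" where
  "lead_mon p = Max (Poly_Mapping.keys p)"

lemma lookup_single_mult:
  fixes p :: "'v cpoly"
  shows "Poly_Mapping.lookup (Poly_Mapping.single u c * p) (u + m) = c * Poly_Mapping.lookup p m"
proof -
  have "Poly_Mapping.single u c * p =
      (\<Sum>k\<in>Poly_Mapping.keys p. Poly_Mapping.single (u + k) (c * Poly_Mapping.lookup p k))"
    by (subst (1) sum_single_lookup[of p, symmetric]) (simp add: sum_distrib_left mult_single)
  then show ?thesis
    by (simp add: lookup_sum lookup_single when_def sum.delta in_keys_iff)
qed

text \<open>One step of multivariate polynomial division. All monomials of the subtracted multiple of \<open>p\<close> are
  at most \<open>lead_mon q\<close>, because the lexicographic order is compatible with multiplication.\<close>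

lemma cancel_lead_mon:
  fixes p q :: "'v::linorder cpoly"
  assumes "p \<noteq> 0" "q \<noteq> 0" "lead_mon q = lead_mon p + u"
  obtains c where "q - Poly_Mapping.single u c * p = 0 \<or>
    lead_mon (q - Poly_Mapping.single u c * p) < lead_mon q"
proof -
  define c where "c = Poly_Mapping.lookup q (lead_mon q) / Poly_Mapping.lookup p (lead_mon p)"
  let ?r = "q - Poly_Mapping.single u c * p"
  have "lead_mon p \<in> Poly_Mapping.keys p"
    unfolding lead_mon_def using assms by (intro Max_in) auto
  then have "Poly_Mapping.lookup p (lead_mon p) \<noteq> 0" by (simp add: in_keys_iff)
  then have "Poly_Mapping.lookup ?r (lead_mon q) = 0"
    using lookup_single_mult[of u c p "lead_mon p"]
    by (simp add: lookup_minus assms(3) c_def add.commute)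
  then have lead: "lead_mon q \<notin> Poly_Mapping.keys ?r" by (simp add: in_keys_iff)
  have "k \<le> lead_mon q" if "k \<in> Poly_Mapping.keys ?r" for k
  proof -
    have "k \<in> Poly_Mapping.keys q \<or> k \<in> Poly_Mapping.keys (Poly_Mapping.single u c * p)"
      using that by (auto simp: in_keys_iff lookup_minus)
    then show ?thesis
    proof
      assume "k \<in> Poly_Mapping.keys q"
      then show ?thesis by (simp add: lead_mon_def)
    next
      assume "k \<in> Poly_Mapping.keys (Poly_Mapping.single u c * p)"
      then obtain l where "l \<in> Poly_Mapping.keys p" "k = u + l"
        using subsetD[OF Poly_Mapping.keys_mult] by (fastforce split: if_splits)
      moreover from this have "l \<le> lead_mon p" by (simp add: lead_mon_def)
      ultimately show ?thesis
        using add_left_mono[of l "lead_mon p" u] by (simp add: assms(3) add.commute)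
    qed
  qed
  moreover have "lead_mon ?r \<in> Poly_Mapping.keys ?r" if "?r \<noteq> 0"
    unfolding lead_mon_def using that by (intro Max_in) auto
  ultimately have "lead_mon ?r < lead_mon q" if "?r \<noteq> 0"
    using lead that by (metis order.not_eq_order_implies_strict)
  then show thesis using that by blast
qed

text \<open>The topological content of Hilbert's basis theorem. If it failed, every finite \<open>F \<subseteq> P\<close> would admit
  some \<open>p \<in> P\<close> that does not vanish on the zero set of \<open>F\<close>. Keep adjoining such a \<open>p\<close> with the
  smallest possible leading monomial. By Dickson's lemma, the leading monomial of some chosen
  polynomial divides that of a later one; cancelling it there yields a candidate with a smaller
  leading monomial, contradicting the choice.\<close>

lemma hilbert_basis_zero_set:
  assumes V: "finite (V :: 'v::linorder set)" and P: "P \<subseteq> polys V"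
    and diff: "\<And>p q. p \<in> P \<Longrightarrow> q \<in> P \<Longrightarrow> p - q \<in> P"
    and mult: "\<And>p m c. p \<in> P \<Longrightarrow> Poly_Mapping.keys m \<subseteq> V \<Longrightarrow> Poly_Mapping.single m c * p \<in> P"
  obtains F where "finite F" "F \<subseteq> P" "zero_set V F = zero_set V P"
proof (rule ccontr)
  assume contr: "\<not> thesis"
  note basis = that
  let ?bad = "\<lambda>F p. p \<in> P \<and> (\<exists>a\<in>zero_set V F. poly_eval p a \<noteq> 0)"
  have keys: "Poly_Mapping.keys (lead_mon p) \<subseteq> V" if "p \<in> P" "p \<noteq> 0" for p
  proof -
    have "lead_mon p \<in> Poly_Mapping.keys p"
      unfolding lead_mon_def using that by (intro Max_in) auto
    then show ?thesis using P that by (auto simp: polys_def)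
  qed
  have ex: "\<exists>p. ?bad F p \<and> (\<forall>q. ?bad F q \<longrightarrow> \<not> lead_mon q < lead_mon p)"
    if F: "finite F" "F \<subseteq> P" for F
  proof -
    have "zero_set V F \<noteq> zero_set V P" using contr basis F by blast
    then have "\<exists>p. ?bad F p" using F(2) unfolding zero_set_def by blast
    then obtain p where p: "?bad F p" by blast
    let ?L = "lead_mon ` {p. ?bad F p}"
    obtain m where m: "m \<in> ?L" and min: "\<And>m'. m' < m \<Longrightarrow>
        Poly_Mapping.keys m' \<subseteq> V \<Longrightarrow> Poly_Mapping.keys m \<subseteq> V \<Longrightarrow> m' \<notin> ?L"
    proof (rule wfE_min[OF wf_mon[OF V], of "lead_mon p" ?L])
      show "lead_mon p \<in> ?L" using p by (intro imageI CollectI)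
    qed auto
    obtain p' where p': "?bad F p'" "m = lead_mon p'" using m by blast
    have nz: "q \<noteq> 0" if "?bad F q" for q using that by auto
    have "\<not> lead_mon q < lead_mon p'" if "?bad F q" for q
    proof
      assume "lead_mon q < lead_mon p'"
      then have "lead_mon q \<notin> ?L"
        using min[of "lead_mon q"] keys[of q] keys[of p'] nz[of q] nz[of p'] that p' by blast
      then show False using that by blast
    qed
    then show ?thesis using p'(1) by blast
  qed
  define G where "G F = (SOME p. ?bad F p \<and> (\<forall>q. ?bad F q \<longrightarrow> \<not> lead_mon q < lead_mon p))" for F
  have G: "?bad F (G F)" "\<And>q. ?bad F q \<Longrightarrow> \<not> lead_mon q < lead_mon (G F)"
    if "finite F" "F \<subseteq> P" for F
    using someI_ex[OF ex[OF that]] unfolding G_def by blast+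
  define H where "H = rec_nat {} (\<lambda>_ F. insert (G F) F)"
  have H_simps: "H 0 = {}" "H (Suc k) = insert (G (H k)) (H k)" for k
    by (simp_all add: H_def)
  have H: "finite (H k) \<and> H k \<subseteq> P" for k
    by (induction k) (use G(1) in \<open>auto simp: H_simps\<close>)
  have H_mono: "H i \<subseteq> H j" if "i \<le> j" for i j
    using that by (rule lift_Suc_mono_le[of H, rotated]) (auto simp: H_simps)
  define p where "p k = G (H k)" for k
  have p: "?bad (H k) (p k)" and p_min: "\<And>q. ?bad (H k) q \<Longrightarrow> \<not> lead_mon q < lead_mon (p k)" for k
    using G[of "H k"] H[of k] unfolding p_def by blast+
  have nz: "p k \<noteq> 0" for k using p[of k] by auto
  obtain i j u where ij: "i < j" and u: "lead_mon (p j) = lead_mon (p i) + u"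
    using dickson[OF V, of "\<lambda>k. lead_mon (p k)"] keys p nz by metis
  obtain c where c: "p j - Poly_Mapping.single u c * p i = 0 \<or>
      lead_mon (p j - Poly_Mapping.single u c * p i) < lead_mon (p j)"
    using cancel_lead_mon[OF nz nz u] by blast
  let ?r = "p j - Poly_Mapping.single u c * p i"
  have "Poly_Mapping.keys u \<subseteq> Poly_Mapping.keys (lead_mon (p j))"
    unfolding u by (auto simp: in_keys_iff lookup_add)
  then have "Poly_Mapping.keys u \<subseteq> V" using keys[of "p j"] p[of j] nz[of j] by blast
  then have rP: "?r \<in> P" using diff mult p by blast
  obtain a where a: "a \<in> zero_set V (H j)" "poly_eval (p j) a \<noteq> 0" using p[of j] by blast
  have "p i \<in> H j" using H_mono[of "Suc i" j] ij by (auto simp: H_simps p_def)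
  then have "poly_eval (p i) a = 0" using a(1) by (simp add: zero_set_def)
  \<comment> \<open>at the witness point the subtracted multiple of \<open>p i\<close> vanishes, so the difference is as bad as \<open>p j\<close>\<close>
  then have ra: "poly_eval ?r a \<noteq> 0" using a(2) by (simp add: poly_eval_diff poly_eval_mult)
  then have "?bad (H j) ?r" using rP a(1) by blast
  moreover have "?r \<noteq> 0" using ra by (metis poly_eval_0)
  ultimately show False using c p_min by blast
qed

section \<open>Noetherian spaces and their irreducible components\<close>

text \<open>The descending chain condition on closed sets, in the form that yields minimal closed sets and
  induction over closed sets.\<close>

definition noetherian_space :: "'a topology \<Rightarrow> bool" where
  "noetherian_space T \<longleftrightarrow> wf {(A, B). closedin T A \<and> closedin T B \<and> A \<subset> B}"

lemma irreducible_in_subtopology: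
  "irreducible_in (subtopology T X) D \<longleftrightarrow> D \<subseteq> X \<and> irreducible_in T D"
proof (cases "D \<subseteq> X")
  case True
  then have "X \<inter> D = D" by blast
  then show ?thesis using True by (auto simp: irreducible_in_def subtopology_subtopology)
qed (auto simp: irreducible_in_def)

lemma irreducible_in_nonempty: "irreducible_in T C \<Longrightarrow> C \<noteq> {}"
  by (auto simp: irreducible_in_def irreducible_space_def)

lemma irreducible_in_singleton: "p \<in> topspace T \<Longrightarrow> irreducible_in T {p}"
proof -
  assume p: "p \<in> topspace T"
  then have top: "topspace (subtopology T {p}) = {p}" by auto
  have "A = {p} \<or> B = {p}" if "{p} = A \<union> B" for A B using that by blast
  then show ?thesis using p unfolding irreducible_in_def irreducible_space_def top by auto
qed

lemma irreducible_in_subset_Un: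
  assumes "irreducible_in T C" "closedin T A" "closedin T B" "C \<subseteq> A \<union> B"
  shows "C \<subseteq> A \<or> C \<subseteq> B"
proof -
  have top: "topspace (subtopology T C) = C"
    using assms(1) by (auto simp: irreducible_in_def)
  have "closedin (subtopology T C) (A \<inter> C)" "closedin (subtopology T C) (B \<inter> C)"
    using assms(2,3) by (auto simp: closedin_subtopology)
  moreover have "C = (A \<inter> C) \<union> (B \<inter> C)" using assms(4) by blast
  ultimately have "A \<inter> C = C \<or> B \<inter> C = C"
    using assms(1) unfolding irreducible_in_def irreducible_space_def top by metis
  then show ?thesis by blast
qed

lemma irreducible_in_subset_Union:
  assumes "irreducible_in T C" "finite F" "\<And>A. A \<in> F \<Longrightarrow> closedin T A" "C \<subseteq> \<Union>F"
  obtains A where "A \<in> F" "C \<subseteq> A"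
proof -
  have "\<exists>A\<in>F. C \<subseteq> A" using assms(2,3,4)
  proof (induction F rule: finite_induct)
    case empty
    then show ?case using irreducible_in_nonempty[OF assms(1)] by simp
  next
    case (insert A F)
    have "closedin T (\<Union>F)" using insert.hyps insert.prems by (intro closedin_Union) auto
    then have "C \<subseteq> A \<or> C \<subseteq> \<Union>F"
      using insert.prems by (intro irreducible_in_subset_Un[OF assms(1)]) auto
    then show ?case using insert by auto
  qed
  then show thesis using that by blast
qed

text \<open>Noetherian induction: a nonempty closed set that is not irreducible splits into two strictly smaller
  closed sets.\<close>

lemma noetherian_irreducible_decomposition:
  assumes "noetherian_space T" "closedin T Z"
  obtains F where "finite F" "\<And>C. C \<in> F \<Longrightarrow> closedin T C \<and> irreducible_in T C" "\<Union>F = Z"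
proof -
  have "\<exists>F. finite F \<and> (\<forall>C\<in>F. closedin T C \<and> irreducible_in T C) \<and> \<Union>F = Z"
    using assms(1)[unfolded noetherian_space_def] assms(2)
  proof (induction Z rule: wf_induct_rule)
    case (less Z)
    have top: "topspace (subtopology T Z) = Z"
      using closedin_subset[OF less.prems] by auto
    consider "Z = {}" | "irreducible_in T Z" | "Z \<noteq> {}" "\<not> irreducible_in T Z" by blast
    then show ?case
    proof cases
      case 1
      then show ?thesis by (intro exI[of _ "{}"]) auto
    next
      case 2
      then show ?thesis using less.prems by (intro exI[of _ "{Z}"]) auto
    next
      case 3
      then obtain A B where AB: "closedin (subtopology T Z) A" "closedin (subtopology T Z) B"
          "Z = A \<union> B" "A \<noteq> Z" "B \<noteq> Z"
        using closedin_subset[OF less.prems]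
        unfolding irreducible_in_def irreducible_space_def top by blast
      have closed: "closedin T A" "closedin T B"
        using AB(1,2) less.prems by (auto intro: closedin_trans_full)
      have sub: "A \<subset> Z" "B \<subset> Z" using AB by auto
      obtain F G where
        "finite F \<and> (\<forall>C\<in>F. closedin T C \<and> irreducible_in T C) \<and> \<Union>F = A"
        "finite G \<and> (\<forall>C\<in>G. closedin T C \<and> irreducible_in T C) \<and> \<Union>G = B"
        using less.IH[of A] less.IH[of B] closed less.prems sub by auto
      then show ?thesis using AB(3) by (intro exI[of _ "F \<union> G"]) auto
    qed
  qed
  then show thesis using that by blast
qed

lemma irreducible_components_subtopology:
  "C \<in> irreducible_components (subtopology T X) \<longleftrightarrow>
     irreducible_in T C \<and> C \<subseteq> X \<and> (\<forall>D. irreducible_in T D \<longrightarrow> D \<subseteq> X \<longrightarrow> C \<subseteq> D \<longrightarrow> D = C)"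
  by (auto simp: irreducible_components_def irreducible_in_subtopology)

lemma component_in_decomposition:
  assumes "C \<in> irreducible_components (subtopology T X)"
    and "finite F" "\<And>D. D \<in> F \<Longrightarrow> closedin T D \<and> irreducible_in T D" "C \<subseteq> \<Union>F" "\<Union>F \<subseteq> X"
  shows "C \<in> F"
proof -
  have C: "irreducible_in T C"
    and max: "\<And>D. irreducible_in T D \<Longrightarrow> D \<subseteq> X \<Longrightarrow> C \<subseteq> D \<Longrightarrow> D = C"
    using assms(1) by (auto simp: irreducible_components_subtopology)
  obtain A where A: "A \<in> F" "C \<subseteq> A"
    using irreducible_in_subset_Union[OF C assms(2) _ assms(4)] assms(3) by blast
  then have "A = C" using assms(3,5) by (intro max) auto
  then show ?thesis using A by simp
qed

lemma component_closed:
  assumes "noetherian_space T" "closedin T X" "C \<in> irreducible_components (subtopology T X)"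
  shows "closedin T C"
proof -
  obtain F where F: "finite F" "\<And>C. C \<in> F \<Longrightarrow> closedin T C \<and> irreducible_in T C" "\<Union>F = X"
    using noetherian_irreducible_decomposition[OF assms(1,2)] by blast
  moreover have "C \<subseteq> X" using assms(3) by (simp add: irreducible_components_subtopology)
  ultimately have "C \<in> F" using component_in_decomposition[OF assms(3)] by (metis order_refl)
  then show ?thesis using F(2) by blast
qed

text \<open>The closure of \<open>S\<close> is a finite union of irreducible closed sets, and \<open>C\<close> is one of them by
  maximality. If \<open>S\<close> avoided \<open>C\<close>, the other members of the union would already cover
  \<open>S\<close>, hence its closure, hence \<open>C\<close>; but then \<open>C\<close> would be one of those others.\<close>

lemma component_meets_dense:
  assumes "noetherian_space T" "C \<in> irreducible_components (subtopology T X)"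
    and S: "C \<subseteq> T closure_of S" "T closure_of S \<subseteq> X" "S \<subseteq> topspace T"
  shows "C \<inter> S \<noteq> {}"
proof
  assume disj: "C \<inter> S = {}"
  obtain F where F: "finite F" "\<And>C. C \<in> F \<Longrightarrow> closedin T C \<and> irreducible_in T C"
      "\<Union>F = T closure_of S"
    using noetherian_irreducible_decomposition[OF assms(1) closedin_closure_of] by blast
  have "S \<subseteq> \<Union>F" using closure_of_subset[OF S(3)] F(3) by simp
  then have "S \<subseteq> \<Union>(F - {C})" using disj by blast
  moreover have "closedin T (\<Union>(F - {C}))"
    using F(1,2) by (intro closedin_Union) auto
  ultimately have "T closure_of S \<subseteq> \<Union>(F - {C})" by (rule closure_of_minimal)
  then have "C \<in> F - {C}"
    using F S by (intro component_in_decomposition[OF assms(2)]) auto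
  then show False by simp
qed

text \<open>Since points are closed, a second point of \<open>C\<close> besides \<open>p\<close> yields the chain \<open>{p} \<subset> C\<close>.\<close>

lemma krull_dim_eq_0_iff:
  assumes C: "irreducible_in T C" "closedin T C" and T1: "\<And>p. p \<in> C \<Longrightarrow> closedin T {p}"
  shows "krull_dim (subtopology T C) = 0 \<longleftrightarrow> (\<exists>p. C = {p})"
proof
  assume dim: "krull_dim (subtopology T C) = 0"
  obtain p where p: "p \<in> C" using irreducible_in_nonempty[OF C(1)] by blast
  show "\<exists>p. C = {p}"
  proof (rule ccontr)
    assume "\<not> (\<exists>p. C = {p})"
    then have psub: "{p} \<subset> C" using p by blast
    define Z where "Z i = (if i = 0 then {p} else C)" for i :: nat
    have top: "p \<in> topspace T" using p closedin_subset[OF C(2)] by blast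
    have "irreducible_in T {p}"
      using top by (rule irreducible_in_singleton)
    moreover have "closedin (subtopology T C) {p}" "closedin (subtopology T C) C"
      using T1[OF p] C(2) p closedin_subset[OF C(2)] by (auto intro: closedin_subset_topspace)
    ultimately have "\<forall>i\<le>1. closedin (subtopology T C) (Z i) \<and> irreducible_in (subtopology T C) (Z i)"
        "\<forall>i<1. Z i \<subset> Z (Suc i)"
      using C p psub by (auto simp: Z_def irreducible_in_subtopology)
    then have "enat 1 \<le> krull_dim (subtopology T C)"
      unfolding krull_dim_def by (intro Sup_upper) blast
    then show False using dim by (simp add: zero_enat_def)
  qed
next
  assume "\<exists>p. C = {p}"
  then obtain p where p: "C = {p}" ..
  have "d = 0" if chain: "\<forall>i\<le>d. closedin (subtopology T C) (Z i) \<and> irreducible_in (subtopology T C) (Z i)"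
      "\<forall>i<d. Z i \<subset> Z (Suc i)" for d Z
  proof (rule ccontr)
    assume "d \<noteq> 0"
    then have "Z 0 \<noteq> {}" "Z 1 \<subseteq> {p}" "Z 0 \<subset> Z 1"
      using chain irreducible_in_nonempty[of "subtopology T C" "Z 0"]
      by (auto simp: irreducible_in_subtopology p)
    then show False by blast
  qed
  then have "krull_dim (subtopology T C) \<le> 0"
    unfolding krull_dim_def by (intro Sup_least) (auto simp: zero_enat_def)
  then show "krull_dim (subtopology T C) = 0" by simp
qed

lemma tail_closure_stabilizes:
  fixes x :: "nat \<Rightarrow> 'a"
  assumes "noetherian_space T"
  obtains N where "\<And>s. s \<ge> N \<Longrightarrow> T closure_of (x ` {s..}) = T closure_of (x ` {N..})"
proof -
  let ?Z = "\<lambda>s. T closure_of (x ` {s..})"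
  obtain A where A: "A \<in> range ?Z"
    "\<And>B. (B, A) \<in> {(A, B). closedin T A \<and> closedin T B \<and> A \<subset> B} \<Longrightarrow> B \<notin> range ?Z"
    using wfE_min[OF assms[unfolded noetherian_space_def], of "?Z 0" "range ?Z"] by blast
  then obtain N where N: "A = ?Z N" by blast
  have "?Z s = ?Z N" if "s \<ge> N" for s
  proof -
    have "?Z s \<subseteq> ?Z N" using that by (intro closure_of_mono image_mono) auto
    moreover have "\<not> ?Z s \<subset> ?Z N" using A(2)[of "?Z s"] unfolding N by auto
    ultimately show ?thesis by blast
  qed
  then show thesis using that by blast
qed

text \<open>The whole closure is \<open>Z\<close> together with finitely many points, and a point outside \<open>Z\<close> is isolated, so
  it is a component. Conversely, a point component inside \<open>Z\<close> meets every late tail by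
  \<open>component_meets_dense\<close>, so the injective sequence would visit it infinitely often.\<close>

lemma tail_closure_eq_nonpoint_components:
  fixes x :: "nat \<Rightarrow> 'a"
  assumes noeth: "noetherian_space T"
    and T1: "\<And>p. p \<in> topspace T \<Longrightarrow> closedin T {p}"
    and x: "range x \<subseteq> topspace T"
    and inj: "inj x"
    and stable: "\<And>s. s \<ge> N \<Longrightarrow> T closure_of (x ` {s..}) = T closure_of (x ` {N..})"
  defines "X \<equiv> T closure_of (range x)"
  defines "Z \<equiv> T closure_of (x ` {N..})"
  shows "X - \<Union>{C \<in> irreducible_components (subtopology T X). \<exists>p. C = {p}} = Z"
proof -
  let ?comps = "irreducible_components (subtopology T X)"
  have "UNIV = {..<N} \<union> {N..}" by auto
  then have "range x = x ` {..<N} \<union> x ` {N..}" by (metis image_Un)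
  moreover have closed_fin: "closedin T (x ` A)" if "finite A" for A
    using closedin_Union[of "(\<lambda>i. {x i}) ` A" T] that T1 x by (auto simp: UNION_singleton_eq_range)
  then have "T closure_of (x ` {..<N}) = x ` {..<N}" by (simp add: closure_of_closedin)
  ultimately have X: "X = x ` {..<N} \<union> Z" unfolding X_def Z_def by (simp add: closure_of_Un)
  have closedZ: "closedin T Z" unfolding Z_def by simp
  show ?thesis
  proof (intro equalityI subsetI)
    fix p assume p: "p \<in> X - \<Union>{C \<in> ?comps. \<exists>p. C = {p}}"
    show "p \<in> Z"
    proof (rule ccontr)
      assume pZ: "p \<notin> Z"
      then obtain i where i: "i < N" "p = x i" using p X by blast
      have "{p} \<in> ?comps"
        unfolding irreducible_components_subtopology
      proof (intro conjI allI impI)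
        show "irreducible_in T {p}"
          using i x by (intro irreducible_in_singleton) auto
        show "{p} \<subseteq> X" using p by blast
        fix D assume D: "irreducible_in T D" "D \<subseteq> X" "{p} \<subseteq> D"
        have "X \<subseteq> {p} \<union> (x ` ({..<N} - {i}) \<union> Z)" unfolding X i by auto
        moreover have pnot: "p \<notin> x ` ({..<N} - {i}) \<union> Z"
          using pZ i inj by (auto simp: inj_def)
        moreover have "closedin T {p}" using T1 i x by blast
        moreover have "closedin T (x ` ({..<N} - {i}) \<union> Z)"
          using closed_fin closedZ by (intro closedin_Un) auto
        moreover have "D \<subseteq> {p} \<union> (x ` ({..<N} - {i}) \<union> Z)" using D(2) calculation(1) by (rule order_trans)
        ultimately have "D \<subseteq> {p} \<or> D \<subseteq> x ` ({..<N} - {i}) \<union> Z"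
          using irreducible_in_subset_Un[OF D(1)] by metis
        then have "D \<subseteq> {p}" using D(3) pnot by blast
        then show "D = {p}" using D(3) by blast
      qed
      then show False using p by blast
    qed
  next
    fix p assume pZ: "p \<in> Z"
    have False if comp: "{p} \<in> ?comps"
    proof -
      have ev: "p \<in> x ` {s..}" if "s \<ge> N" for s
      proof -
        have "T closure_of (x ` {s..}) = Z" using stable[OF that] by (simp add: Z_def)
        moreover have "x ` {s..} \<subseteq> topspace T" using x by blast
        moreover have "{p} \<subseteq> Z" "Z \<subseteq> X" using pZ X by blast+
        ultimately have "{p} \<inter> x ` {s..} \<noteq> {}"
          using component_meets_dense[OF noeth comp, of "x ` {s..}"] by simp
        then show ?thesis by blast
      qed
      from ev[of N] obtain t where t: "p = x t" by auto
      from ev[of "max N (Suc t)"] obtain s where "p = x s" "s > t" by auto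
      then show False using t inj by (auto simp: inj_def)
    qed
    then show "p \<in> X - \<Union>{C \<in> ?comps. \<exists>p. C = {p}}" using pZ X by auto
  qed
qed

section \<open>The Zariski topology is Noetherian and T1\<close>

text \<open>For a descending chain of closed sets, let \<open>P\<close> be the union of the vanishing ideals of its
  members. Finitely many elements of \<open>P\<close> have the same zero set as \<open>P\<close>, and they all vanish on one
  member of the chain, where the chain therefore stops.\<close>

lemma noetherian_zariski:
  assumes V: "finite (V :: 'v::linorder set)"
  shows "noetherian_space (zariski V)"
  unfolding noetherian_space_def wf_iff_no_infinite_down_chain
proof
  assume "\<exists>Z. \<forall>i. (Z (Suc i), Z i) \<in>
    {(A, B). closedin (zariski V) A \<and> closedin (zariski V) B \<and> A \<subset> B}"
  then obtain Z where "\<And>i. (Z (Suc i), Z i) \<in>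
      {(A, B). closedin (zariski V) A \<and> closedin (zariski V) B \<and> A \<subset> B}" by blast
  then have closed: "\<And>i. closedin (zariski V) (Z i)" and less: "\<And>i. Z (Suc i) \<subset> Z i" by blast+
  have anti: "Z j \<subseteq> Z i" if "i \<le> j" for i j
    using that by (rule lift_Suc_antimono_le[of Z, rotated]) (use less in blast)
  let ?P = "{p \<in> polys V. \<exists>i. \<forall>a\<in>Z i. poly_eval p a = 0}"
  have P_diff: "p - q \<in> ?P" if pq: "p \<in> ?P" "q \<in> ?P" for p q
  proof -
    obtain i j where ij: "\<forall>a\<in>Z i. poly_eval p a = 0" "\<forall>a\<in>Z j. poly_eval q a = 0"
      using pq by blast
    have "\<forall>a\<in>Z (max i j). poly_eval (p - q) a = 0"
      using ij subsetD[OF anti[of i "max i j"]] subsetD[OF anti[of j "max i j"]]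
      by (simp add: poly_eval_diff)
    then show ?thesis using pq polys_diff by blast
  qed
  have P_mult: "Poly_Mapping.single m c * p \<in> ?P"
    if p: "p \<in> ?P" and m: "Poly_Mapping.keys m \<subseteq> V" for p m c
  proof -
    obtain i where "\<forall>a\<in>Z i. poly_eval p a = 0" using p by blast
    then have "\<forall>a\<in>Z i. poly_eval (Poly_Mapping.single m c * p) a = 0"
      by (simp add: poly_eval_mult)
    then show ?thesis using p polys_mult[OF polys_single[OF m]] by blast
  qed
  have P_sub: "?P \<subseteq> polys V" by blast
  obtain F where F: "finite F" "F \<subseteq> ?P" "zero_set V F = zero_set V ?P"
    by (rule hilbert_basis_zero_set[OF V P_sub]) (assumption | rule P_diff | rule P_mult)+
  have "\<exists>N. \<forall>p\<in>F. \<forall>a\<in>Z N. poly_eval p a = 0"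
    using F(1,2)
  proof (induction F rule: finite_induct)
    case (insert p F)
    then obtain N i where N: "\<forall>p\<in>F. \<forall>a\<in>Z N. poly_eval p a = 0" and i: "\<forall>a\<in>Z i. poly_eval p a = 0"
      by auto
    show ?case
      using N i subsetD[OF anti[of N "max N i"]] subsetD[OF anti[of i "max N i"]]
      by (intro exI[of _ "max N i"]) simp
  qed simp
  then obtain N where N: "\<forall>p\<in>F. \<forall>a\<in>Z N. poly_eval p a = 0" by blast
  have "Z N \<subseteq> zero_set V F"
    using N closedin_subset[OF closed[of N]] by (auto simp: zero_set_def)
  moreover obtain R where R: "R \<subseteq> polys V" "Z (Suc N) = zero_set V R"
    using closed[of "Suc N"] unfolding closedin_zariski by blast
  then have "\<forall>p\<in>R. \<forall>a\<in>Z (Suc N). poly_eval p a = 0" by (simp add: zero_set_def)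
  then have "R \<subseteq> ?P" using R(1) by blast
  then have "zero_set V ?P \<subseteq> Z (Suc N)" unfolding R zero_set_def by blast
  ultimately show False using F(3) less[of N] by blast
qed

lemma closedin_zariski_singleton:
  assumes p: "p \<in> affine_space V"
  shows "closedin (zariski V) {p}"
proof -
  let ?f = "\<lambda>v. Poly_Mapping.single (Poly_Mapping.single v (Suc 0)) 1 - Poly_Mapping.single 0 (p v)"
  have ev: "poly_eval (?f v) a = a v - p v" for v a
    unfolding poly_eval_diff poly_eval_var poly_eval_const ..
  have sub: "?f ` V \<subseteq> polys V" by (auto intro!: polys_diff polys_const polys_single)
  have "zero_set V (?f ` V) = {p}"
  proof (intro equalityI subsetI)
    fix a assume "a \<in> zero_set V (?f ` V)"
    then have "a \<in> affine_space V" "\<forall>v\<in>V. a v = p v" unfolding zero_set_def by (auto simp: ev)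
    then have "a = p" using PiE_ext[OF _ p] by blast
    then show "a \<in> {p}" by simp
  qed (use p in \<open>auto simp: zero_set_def ev\<close>)
  then show ?thesis unfolding closedin_zariski using sub by metis
qed

text \<open>A nonempty open subset of an irreducible space is dense.\<close>

lemma nonzero_locus_dense_open:
  assumes C: "irreducible_in (zariski V) C" and q: "q \<in> polys V" and b: "b \<in> C" "poly_eval q b \<noteq> 0"
  shows "dense_open_in (subtopology (zariski V) C) {a \<in> C. poly_eval q a \<noteq> 0}" (is "dense_open_in ?T ?U")
proof -
  have sub: "C \<subseteq> affine_space V" using C by (auto simp: irreducible_in_def)
  then have top: "topspace ?T = C" by auto
  have "openin (zariski V) (affine_space V - zero_set V {q})"
    unfolding openin_zariski using q by blast
  moreover have "?U = (affine_space V - zero_set V {q}) \<inter> C"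
    using sub by (auto simp: zero_set_def)
  ultimately have op: "openin ?T ?U" unfolding openin_subtopology by blast
  have cover: "C = (?T closure_of ?U) \<union> (C - ?U)"
    using closure_of_subset[of ?U ?T] closure_of_subset_topspace[of ?T ?U] unfolding top by blast
  have closed: "closedin ?T (C - ?U)" using op openin_closedin_eq[of ?T ?U] by (simp only: top)
  have "A = C \<or> B = C" if "closedin ?T A" "closedin ?T B" "C = A \<union> B" for A B
    using C that unfolding irreducible_in_def irreducible_space_def top by simp
  from this[OF closedin_closure_of closed cover] have "?T closure_of ?U = C"
    using b by blast
  then show ?thesis using op unfolding dense_open_in_def top by blast
qed

section \<open>Germs of regular functions\<close>

text \<open>The germ of \<open>g\<close> at \<open>b\<close> is a fraction whose denominator does not vanish at \<open>b\<close>. The function \<open>g\<close>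
  itself is total; nothing is required where the denominator vanishes, so the
  values that HOL assigns to divisions by zero are harmless.\<close>

definition regular_at :: "'v set \<Rightarrow> ('v \<Rightarrow> complex) \<Rightarrow> (('v \<Rightarrow> complex) \<Rightarrow> complex) \<Rightarrow> bool" where
  "regular_at V b g \<longleftrightarrow> (\<exists>p\<in>polys V. \<exists>q\<in>polys V. poly_eval q b \<noteq> 0 \<and>
     (\<forall>a. poly_eval q a \<noteq> 0 \<longrightarrow> g a = poly_eval p a / poly_eval q a))"

lemma regular_at_poly: "p \<in> polys V \<Longrightarrow> regular_at V b (poly_eval p)"
  unfolding regular_at_def using polys_const[of 1 V]
  by (intro bexI[of _ p] bexI[of _ 1]) auto

lemma regular_at_const: "regular_at V b (\<lambda>_. c)"
  using regular_at_poly[OF polys_const[of c V], of b]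
  by (simp add: poly_eval_const[abs_def] del: poly_eval_single)

lemma regular_at_coord: "v \<in> V \<Longrightarrow> regular_at V b (\<lambda>a. a v)"
  using regular_at_poly[OF polys_single[of "Poly_Mapping.single v (Suc 0)" V 1], of b]
  by (simp add: poly_eval_var[abs_def] del: poly_eval_single)

lemma regular_at_add:
  assumes "regular_at V b f" "regular_at V b g"
  shows "regular_at V b (\<lambda>a. f a + g a)"
proof -
  obtain p q where 1: "p \<in> polys V" "q \<in> polys V" "poly_eval q b \<noteq> 0"
      "\<And>a. poly_eval q a \<noteq> 0 \<Longrightarrow> f a = poly_eval p a / poly_eval q a"
    using assms(1) unfolding regular_at_def by blast
  obtain r s where 2: "r \<in> polys V" "s \<in> polys V" "poly_eval s b \<noteq> 0"
      "\<And>a. poly_eval s a \<noteq> 0 \<Longrightarrow> g a = poly_eval r a / poly_eval s a"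
    using assms(2) unfolding regular_at_def by blast
  show ?thesis unfolding regular_at_def
    using 1 2 by (intro bexI[of _ "p * s + r * q"] bexI[of _ "q * s"])
      (auto simp: poly_eval_add poly_eval_mult add_frac_eq intro!: polys_add polys_mult)
qed

lemma regular_at_mult:
  assumes "regular_at V b f" "regular_at V b g"
  shows "regular_at V b (\<lambda>a. f a * g a)"
proof -
  obtain p q where 1: "p \<in> polys V" "q \<in> polys V" "poly_eval q b \<noteq> 0"
      "\<And>a. poly_eval q a \<noteq> 0 \<Longrightarrow> f a = poly_eval p a / poly_eval q a"
    using assms(1) unfolding regular_at_def by blast
  obtain r s where 2: "r \<in> polys V" "s \<in> polys V" "poly_eval s b \<noteq> 0"
      "\<And>a. poly_eval s a \<noteq> 0 \<Longrightarrow> g a = poly_eval r a / poly_eval s a"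
    using assms(2) unfolding regular_at_def by blast
  show ?thesis unfolding regular_at_def
    using 1 2 by (intro bexI[of _ "p * r"] bexI[of _ "q * s"])
      (auto simp: poly_eval_mult intro!: polys_mult)
qed

lemma regular_at_diff:
  assumes "regular_at V b f" "regular_at V b g"
  shows "regular_at V b (\<lambda>a. f a - g a)"
  using regular_at_add[OF assms(1) regular_at_mult[OF regular_at_const[of V b "-1"] assms(2)]] by simp

lemma regular_at_divide:
  assumes "regular_at V b f" "regular_at V b g" "g b \<noteq> 0"
  shows "regular_at V b (\<lambda>a. f a / g a)"
proof -
  obtain r s where 2: "r \<in> polys V" "s \<in> polys V" "poly_eval s b \<noteq> 0"
      "\<And>a. poly_eval s a \<noteq> 0 \<Longrightarrow> g a = poly_eval r a / poly_eval s a"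
    using assms(2) unfolding regular_at_def by blast
  have "poly_eval r b \<noteq> 0" using 2 assms(3) by auto
  then have "regular_at V b (\<lambda>a. 1 / g a)" unfolding regular_at_def
    using 2 by (intro bexI[of _ "s * s"] bexI[of _ "r * s"])
      (auto simp: poly_eval_mult intro!: polys_mult)
  from regular_at_mult[OF assms(1) this] show ?thesis by simp
qed

lemma regular_at_sum: "(\<And>i. i \<in> I \<Longrightarrow> regular_at V b (f i)) \<Longrightarrow> regular_at V b (\<lambda>a. \<Sum>i\<in>I. f i a)"
  by (induction I rule: infinite_finite_induct) (auto intro: regular_at_const regular_at_add)

lemma regular_at_prod: "(\<And>i. i \<in> I \<Longrightarrow> regular_at V b (f i)) \<Longrightarrow> regular_at V b (\<lambda>a. \<Prod>i\<in>I. f i a)"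
  by (induction I rule: infinite_finite_induct) (auto intro: regular_at_const regular_at_mult)

lemma regular_at_power: "regular_at V b f \<Longrightarrow> regular_at V b (\<lambda>a. f a ^ k)"
  by (induction k) (auto intro: regular_at_const regular_at_mult)

lemma regular_at_mon_eval:
  assumes "\<And>v. v \<in> V \<Longrightarrow> regular_at V b (\<lambda>a. F a v)" "Poly_Mapping.keys m \<subseteq> V"
  shows "regular_at V b (\<lambda>a. mon_eval m (F a))"
  unfolding mon_eval_def using assms by (intro regular_at_prod regular_at_power) auto

text \<open>Polynomials may be applied to a whole tuple \<open>F\<close> of regular functions, so that iterates are
  handled without substituting rational functions into each other.\<close>

lemma regular_at_poly_eval:
  assumes "\<And>v. v \<in> V \<Longrightarrow> regular_at V b (\<lambda>a. F a v)" "p \<in> polys V"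
  shows "regular_at V b (\<lambda>a. poly_eval p (F a))"
  unfolding poly_eval_def using assms
  by (intro regular_at_sum regular_at_mult regular_at_const regular_at_mon_eval) (auto simp: polys_def)

lemma regular_at_nonzero_nearby:
  assumes "regular_at V b g" "g b \<noteq> 0"
  obtains q where "q \<in> polys V" "poly_eval q b \<noteq> 0" "\<And>a. poly_eval q a \<noteq> 0 \<Longrightarrow> g a \<noteq> 0"
proof -
  obtain p q where "p \<in> polys V" "q \<in> polys V" "poly_eval q b \<noteq> 0"
      "\<And>a. poly_eval q a \<noteq> 0 \<Longrightarrow> g a = poly_eval p a / poly_eval q a"
    using assms(1) unfolding regular_at_def by blast
  then show thesis
    using assms(2) by (intro that[of "p * q"]) (auto simp: poly_eval_mult intro: polys_mult)
qed

section \<open>Linear independence as an open condition\<close>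

text \<open>The functions \<open>h i\<close>, for \<open>i \<in> I\<close>, are linearly independent after restriction to \<open>T\<close>; a
  repeated function counts as a dependence, since the family and not its image is considered.\<close>

definition lin_indep :: "'i set \<Rightarrow> 't set \<Rightarrow> ('i \<Rightarrow> 't \<Rightarrow> complex) \<Rightarrow> bool" where
  "lin_indep I T h \<longleftrightarrow> (\<forall>c. (\<forall>t\<in>T. (\<Sum>i\<in>I. c i * h i t) = 0) \<longrightarrow> (\<forall>i\<in>I. c i = 0))"

lemma lin_indep_spanning_subset:
  fixes h :: "'i \<Rightarrow> 't \<Rightarrow> complex"
  assumes "finite M"
  obtains B where "B \<subseteq> M" "lin_indep B T h"
    "\<And>c. \<exists>d. \<forall>t\<in>T. (\<Sum>i\<in>M. c i * h i t) = (\<Sum>i\<in>B. d i * h i t)"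
proof -
  have "\<exists>B\<subseteq>M. lin_indep B T h \<and> (\<forall>c. \<exists>d. \<forall>t\<in>T. (\<Sum>i\<in>M. c i * h i t) = (\<Sum>i\<in>B. d i * h i t))"
    using assms
  proof (induction M rule: finite_induct)
    case empty
    show ?case by (intro exI[of _ "{}"]) (auto simp: lin_indep_def)
  next
    case (insert m M)
    then obtain B where B: "B \<subseteq> M" "lin_indep B T h"
      "\<And>c. \<exists>d. \<forall>t\<in>T. (\<Sum>i\<in>M. c i * h i t) = (\<Sum>i\<in>B. d i * h i t)" by blast
    have mB: "m \<notin> B" "finite B" using B(1) insert.hyps finite_subset by auto
    have sum: "(\<Sum>i\<in>insert m B. e i * h i t) = e m * h m t + (\<Sum>i\<in>B. e i * h i t)" for e t
      using mB by simp
    show ?case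
    proof (cases "lin_indep (insert m B) T h")
      case True
      have "\<exists>d. \<forall>t\<in>T. (\<Sum>i\<in>insert m M. c i * h i t) = (\<Sum>i\<in>insert m B. d i * h i t)" for c
      proof -
        obtain d where d: "\<And>t. t \<in> T \<Longrightarrow> (\<Sum>i\<in>M. c i * h i t) = (\<Sum>i\<in>B. d i * h i t)"
          using B(3) by blast
        have "(\<Sum>i\<in>B. (d(m := c m)) i * h i t) = (\<Sum>i\<in>B. d i * h i t)" for t
          using mB by (intro sum.cong) auto
        then show ?thesis
          using d insert.hyps by (intro exI[of _ "d(m := c m)"]) (simp add: sum del: fun_upd_apply, simp)
      qed
      then show ?thesis using True B(1) by (intro exI[of _ "insert m B"]) auto
    next
      case False
      then obtain e where e: "\<And>t. t \<in> T \<Longrightarrow> e m * h m t + (\<Sum>i\<in>B. e i * h i t) = 0"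
          "\<exists>i\<in>insert m B. e i \<noteq> 0"
        unfolding lin_indep_def sum by blast
      have em: "e m \<noteq> 0"
      proof
        assume "e m = 0"
        then show False using e B(2) unfolding lin_indep_def by auto
      qed
      have "\<exists>d. \<forall>t\<in>T. (\<Sum>i\<in>insert m M. c i * h i t) = (\<Sum>i\<in>B. d i * h i t)" for c
      proof -
        obtain d where d: "\<And>t. t \<in> T \<Longrightarrow> (\<Sum>i\<in>M. c i * h i t) = (\<Sum>i\<in>B. d i * h i t)"
          using B(3) by blast
        have "(\<Sum>i\<in>insert m M. c i * h i t) = (\<Sum>i\<in>B. (d i - c m / e m * e i) * h i t)"
          if t: "t \<in> T" for t
        proof -
          have "h m t = - (\<Sum>i\<in>B. e i * h i t) / e m"
            using e(1)[OF t] em by (simp add: field_simps eq_neg_iff_add_eq_0)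
          then show ?thesis
            using insert.hyps d[OF t]
            by (simp add: left_diff_distrib sum_subtractf mult.assoc sum_distrib_left sum_divide_distrib)
        qed
        then show ?thesis by (intro exI[of _ "\<lambda>i. d i - c m / e m * e i"] ballI)
      qed
      then show ?thesis using B(1,2) by (intro exI[of _ B] conjI allI) auto
    qed
  qed
  then show thesis using that by blast
qed

text \<open>Gaussian elimination in place of minors. If \<open>g m\<close> is one of the sequences, some entry
  \<open>g m s\<close> is nonzero at \<open>b\<close>, hence near \<open>b\<close>. Using it as a pivot to eliminate \<open>g m\<close> from the
  remaining sequences preserves independence in both directions wherever the pivot does not
  vanish, and the smaller family is independent near \<open>b\<close> by induction. The family is indexed by
  infinitely many \<open>t\<close>, but only the finitely many pivot entries constrain the neighbourhood.\<close>

lemma lin_indep_nearby: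
  fixes g :: "'i \<Rightarrow> 't \<Rightarrow> ('v \<Rightarrow> complex) \<Rightarrow> complex"
  assumes "finite I" "\<And>i t. i \<in> I \<Longrightarrow> regular_at V b (g i t)" "lin_indep I UNIV (\<lambda>i t. g i t b)"
  shows "\<exists>q\<in>polys V. poly_eval q b \<noteq> 0 \<and>
    (\<forall>a. poly_eval q a \<noteq> 0 \<longrightarrow> lin_indep I UNIV (\<lambda>i t. g i t a))"
  using assms
proof (induction I arbitrary: g rule: finite_induct)
  case empty
  show ?case
    by (intro bexI[of _ "Poly_Mapping.single 0 1"])
      (auto simp: lin_indep_def poly_eval_const polys_const simp del: single_one poly_eval_single)
next
  case (insert m I)
  have sum: "(\<Sum>i\<in>insert m I. c i * g i t a) = c m * g m t a + (\<Sum>i\<in>I. c i * g i t a)" for c t a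
    using insert.hyps by simp
  have "\<exists>s. g m s b \<noteq> 0"
  proof (rule ccontr)
    assume "\<nexists>s. g m s b \<noteq> 0"
    then have "\<forall>t. (\<Sum>i\<in>insert m I. (if i = m then 1 else 0) * g i t b) = 0"
      using insert.hyps by (auto intro!: sum.neutral)
    then have "\<forall>i\<in>insert m I. (if i = m then 1 else 0) = (0::complex)"
      by (intro insert.prems(2)[unfolded lin_indep_def, THEN spec, THEN mp] ballI) simp
    then show False by simp
  qed
  then obtain s where s: "g m s b \<noteq> 0" by blast
  define g' where "g' i t a = g i t a * g m s a - g m t a * g i s a" for i t a
  have elim: "(\<Sum>i\<in>I. c i * g' i t a) =
      g m s a * (\<Sum>i\<in>I. c i * g i t a) - g m t a * (\<Sum>i\<in>I. c i * g i s a)" for c t a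
    by (simp add: g'_def sum_distrib_left sum_subtractf algebra_simps)
  have "lin_indep I UNIV (\<lambda>i t. g' i t b)"
    unfolding lin_indep_def
  proof (intro allI impI)
    fix c assume c: "\<forall>t\<in>UNIV. (\<Sum>i\<in>I. c i * g' i t b) = 0"
    \<comment> \<open>a relation among the eliminated sequences, rewritten as one among the original sequences\<close>
    define e where "e i = (if i = m then - (\<Sum>i\<in>I. c i * g i s b) else c i * g m s b)" for i
    have "(\<Sum>i\<in>insert m I. e i * g i t b) = 0" for t
    proof -
      have "(\<Sum>i\<in>I. e i * g i t b) = g m s b * (\<Sum>i\<in>I. c i * g i t b)"
        unfolding sum_distrib_left using insert.hyps by (intro sum.cong) (auto simp: e_def)
      then show ?thesis using c elim[of c t b] unfolding sum by (simp add: e_def)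
    qed
    then have "\<forall>i\<in>insert m I. e i = 0" using insert.prems(2) unfolding lin_indep_def by blast
    then show "\<forall>i\<in>I. c i = 0" using s insert.hyps by (auto simp: e_def split: if_splits)
  qed
  moreover have "regular_at V b (g' i t)" if "i \<in> I" for i t
    unfolding g'_def[abs_def] using that insert.prems(1)
    by (intro regular_at_diff regular_at_mult) auto
  ultimately obtain q where q: "q \<in> polys V" "poly_eval q b \<noteq> 0"
      "\<And>a. poly_eval q a \<noteq> 0 \<Longrightarrow> lin_indep I UNIV (\<lambda>i t. g' i t a)"
    using insert.IH[of g'] by blast
  obtain r where r: "r \<in> polys V" "poly_eval r b \<noteq> 0" "\<And>a. poly_eval r a \<noteq> 0 \<Longrightarrow> g m s a \<noteq> 0"
    using regular_at_nonzero_nearby[OF insert.prems(1) s] by blast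
  have "lin_indep (insert m I) UNIV (\<lambda>i t. g i t a)" if a: "poly_eval (q * r) a \<noteq> 0" for a
    unfolding lin_indep_def
  proof (intro allI impI)
    fix c assume "\<forall>t\<in>UNIV. (\<Sum>i\<in>insert m I. c i * g i t a) = 0"
    then have rel: "(\<Sum>i\<in>I. c i * g i t a) = - c m * g m t a" for t
      unfolding sum by (simp add: eq_neg_iff_add_eq_0 add.commute)
    have "\<forall>t\<in>UNIV. (\<Sum>i\<in>I. c i * g' i t a) = 0" unfolding elim rel by simp
    then have cI: "\<forall>i\<in>I. c i = 0"
      using q(3)[of a] a unfolding lin_indep_def by (simp add: poly_eval_mult)
    then have "c m * g m s a = 0" using rel[of s] by simp
    then have "c m = 0" using r(3)[of a] a by (simp add: poly_eval_mult)
    then show "\<forall>i\<in>insert m I. c i = 0" using cI by simp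
  qed
  then show ?case
    using q r by (intro bexI[of _ "q * r"]) (auto simp: poly_eval_mult intro: polys_mult)
qed

section \<open>Monomials of bounded exponents\<close>

text \<open>Any exhaustion of the monomials by finite sets would serve; bounding each exponent
  separately makes finiteness immediate.\<close>

definition bounded_mons :: "'v set \<Rightarrow> nat \<Rightarrow> ('v \<Rightarrow>\<^sub>0 nat) set" where
  "bounded_mons V d = {m. Poly_Mapping.keys m \<subseteq> V \<and> (\<forall>v. Poly_Mapping.lookup m v \<le> d)}"

lemma finite_bounded_mons:
  assumes "finite V"
  shows "finite (bounded_mons V d)"
proof -
  let ?r = "\<lambda>m. restrict (Poly_Mapping.lookup m) V"
  have "inj_on ?r (bounded_mons V d)"
  proof (rule inj_onI)
    fix m m' assume m: "m \<in> bounded_mons V d" "m' \<in> bounded_mons V d" "?r m = ?r m'"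
    show "m = m'"
    proof (rule poly_mapping_eqI)
      fix v
      show "Poly_Mapping.lookup m v = Poly_Mapping.lookup m' v"
      proof (cases "v \<in> V")
        case True
        then show ?thesis using fun_cong[OF m(3), of v] by simp
      next
        case False
        then have "v \<notin> Poly_Mapping.keys m" "v \<notin> Poly_Mapping.keys m'"
          using m by (auto simp: bounded_mons_def)
        then show ?thesis by (simp add: in_keys_iff)
      qed
    qed
  qed
  moreover have "?r ` bounded_mons V d \<subseteq> (\<Pi>\<^sub>E v\<in>V. {..d})" by (auto simp: bounded_mons_def)
  moreover have "finite (\<Pi>\<^sub>E v\<in>V. {..d})" using assms by (intro finite_PiE) auto
  ultimately show ?thesis by (meson finite_imageD finite_subset)
qed

lemma poly_bounded_mons:
  assumes "p \<in> polys V"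
  obtains d where "d \<ge> 1" "Poly_Mapping.keys p \<subseteq> bounded_mons V d"
proof -
  let ?f = "\<lambda>m. \<Sum>v\<in>Poly_Mapping.keys m. Poly_Mapping.lookup m v"
  have 1: "Poly_Mapping.lookup m v \<le> ?f m" for m :: "'a \<Rightarrow>\<^sub>0 nat" and v
    by (cases "v \<in> Poly_Mapping.keys m") (auto simp: in_keys_iff intro: member_le_sum)
  have 2: "?f m \<le> (\<Sum>m\<in>Poly_Mapping.keys p. ?f m)" if "m \<in> Poly_Mapping.keys p" for m
    using that by (intro member_le_sum) auto
  have "Poly_Mapping.lookup m v \<le> Suc (\<Sum>m\<in>Poly_Mapping.keys p. ?f m)"
    if "m \<in> Poly_Mapping.keys p" for m v
    using order_trans[OF 1 2[OF that]] le_SucI by blast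
  then show thesis
    using assms by (intro that[of "Suc (\<Sum>m\<in>Poly_Mapping.keys p. ?f m)"])
      (auto simp: bounded_mons_def polys_def)
qed

section \<open>Coxeter iterates as regular functions\<close>

abbreviation "ones Q \<equiv> (\<lambda>k\<in>verts Q. 1 :: complex)"

lemma coxeter_mutation_apply: "k \<in> verts Q \<Longrightarrow> coxeter_mutation Q a k = coxeter_coord Q a k"
  by (simp add: coxeter_mutation_def)

text \<open>The induction follows the recursion for the coordinates: the only denominators are the old
  coordinates.\<close>

lemma regular_at_coxeter_coord:
  assumes "wf_digraph Q" and reg: "\<And>v. v \<in> verts Q \<Longrightarrow> regular_at (verts Q) b (\<lambda>a. F a v)"
    and nz: "\<And>v. v \<in> verts Q \<Longrightarrow> F b v \<noteq> 0"
    and "k \<in> verts Q"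
  shows "regular_at (verts Q) b (\<lambda>a. coxeter_coord Q (F a) k)"
  using assms(4)
proof (induction k rule: less_induct)
  case (less k)
  have "tail Q e \<in> verts Q" "head Q e \<in> verts Q" if "e \<in> arcs Q" for e
    using wf_digraph.wellformed[OF assms(1) that] by blast+
  then show ?case
    using less nz reg by (subst coxeter_coord.simps)
      (intro regular_at_divide regular_at_add regular_at_mult regular_at_const regular_at_prod; auto)
qed

lemma regular_at_coxeter_iterate:
  assumes "wf_digraph Q" "\<And>s v. s < t \<Longrightarrow> v \<in> verts Q \<Longrightarrow> (coxeter_mutation Q ^^ s) b v \<noteq> 0"
    and "k \<in> verts Q"
  shows "regular_at (verts Q) b (\<lambda>a. (coxeter_mutation Q ^^ t) a k)"
  using assms(2,3)
proof (induction t arbitrary: k)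
  case 0
  then show ?case by (simp add: regular_at_coord)
next
  case (Suc t)
  have "regular_at (verts Q) b (\<lambda>a. coxeter_coord Q ((coxeter_mutation Q ^^ t) a) k)"
    using Suc by (intro regular_at_coxeter_coord assms(1)) auto
  then show ?case using Suc.prems(2) by (simp add: coxeter_mutation_apply)
qed

lemma coxeter_iterate_affine:
  "a \<in> affine_space (verts Q) \<Longrightarrow> (coxeter_mutation Q ^^ t) a \<in> affine_space (verts Q)"
  by (induction t) (auto simp: coxeter_mutation_def)

text \<open>Positivity is preserved because the recursion is free of subtraction. This is why the point
  with all coordinates 1 is a generic specialization.\<close>

lemma coxeter_coord_pos:
  assumes "wf_digraph Q" and pos: "\<And>v. v \<in> verts Q \<Longrightarrow> \<exists>r>0. a v = of_real r"
    and "k \<in> verts Q"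
  shows "\<exists>r>0. coxeter_coord Q a k = of_real r"
  using assms(3)
proof (induction k rule: less_induct)
  case (less k)
  have prod: "\<exists>r>0. (\<Prod>e\<in>A. f e :: complex) = of_real r" if "\<And>e. e \<in> A \<Longrightarrow> \<exists>r>0. f e = of_real r"
    for A :: "'a set" and f
    using that
  proof (induction A rule: infinite_finite_induct)
    case (insert x A)
    then have "\<exists>r>0. f x = of_real r" "\<exists>s>0. prod f A = of_real s" by blast+
    then obtain r s where "r > 0" "s > 0" "f x = of_real r" "prod f A = of_real s" by blast
    then show ?case using insert.hyps by (intro exI[of _ "r * s"]) simp
  qed (auto intro: exI[of _ 1])
  have "tail Q e \<in> verts Q" "head Q e \<in> verts Q" if "e \<in> arcs Q" for e
    using wf_digraph.wellformed[OF assms(1) that] by blast+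
  then have "\<exists>r>0. (\<Prod>e\<in>in_arcs Q k. a (tail Q e)) = of_real r"
    "\<exists>r>0. (\<Prod>e\<in>{e \<in> out_arcs Q k. head Q e < k}. coxeter_coord Q a (head Q e)) = of_real r"
    using pos less by (auto intro!: prod)
  moreover obtain x where "x > 0" "a k = of_real x" using pos less.prems by blast
  ultimately obtain r s x where rs: "r > 0" "s > 0" "x > 0" "a k = of_real x"
    "(\<Prod>e\<in>in_arcs Q k. a (tail Q e)) = of_real r"
    "(\<Prod>e\<in>{e \<in> out_arcs Q k. head Q e < k}. coxeter_coord Q a (head Q e)) = of_real s" by blast
  have "coxeter_coord Q a k = of_real ((1 + r * s) / x)"
    by (subst coxeter_coord.simps, unfold rs) simp
  moreover have "(1 + r * s) / x > 0" using rs by (simp add: add_pos_pos)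
  ultimately show ?case by blast
qed

lemma frieze_orbit_nonzero:
  assumes "wf_digraph Q" "k \<in> verts Q"
  shows "(coxeter_mutation Q ^^ t) (ones Q) k \<noteq> 0"
proof -
  have "\<exists>r>0. (coxeter_mutation Q ^^ t) (ones Q) k = of_real r" if "k \<in> verts Q" for k
    using that
  proof (induction t arbitrary: k)
    case 0
    then show ?case by (intro exI[of _ 1]) simp
  next
    case (Suc t)
    then show ?case by (simp add: coxeter_mutation_apply coxeter_coord_pos[OF assms(1)])
  qed
  then show ?thesis using assms(2) by force
qed

lemma funpow_range_finite:
  fixes f :: "'a \<Rightarrow> 'a"
  assumes "(f ^^ s) x = (f ^^ t) x" "s < t"
  shows "finite (range (\<lambda>n. (f ^^ n) x))"
proof -
  have "(f ^^ n) x \<in> (\<lambda>i. (f ^^ i) x) ` {..<t}" for n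
  proof (induction n rule: less_induct)
    case (less n)
    show ?case
    proof (cases "n < t")
      case False
      have "(f ^^ n) x = (f ^^ (n - t)) ((f ^^ t) x)"
        using False by (simp flip: funpow_add[THEN fun_cong, unfolded comp_def])
      also have "\<dots> = (f ^^ (n - t + s)) x" by (simp add: assms(1)[symmetric] funpow_add)
      finally show ?thesis using less[of "n - t + s"] assms(2) False by simp
    qed auto
  qed
  then show ?thesis by (auto intro: finite_subset[of _ "(\<lambda>i. (f ^^ i) x) ` {..<t}"])
qed

section \<open>Closures of Coxeter orbits\<close>

text \<open>Continuity of the iterates. If the \<open>t\<close>-th iterate left \<open>Z\<close> at \<open>a\<close>, it would do so on a neighbourhood
  of \<open>a\<close>. That neighbourhood contains a point of the tail, whose \<open>t\<close>-th iterate lies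
  again in the tail.\<close>

lemma coxeter_iterate_tail_closure:
  fixes Q :: "(nat, 'e) pre_digraph"
  assumes "wf_digraph Q"
    and x: "x \<in> affine_space (verts Q)"
    and stable: "\<And>s. s \<ge> N \<Longrightarrow> zariski (verts Q) closure_of ((\<lambda>t. (coxeter_mutation Q ^^ t) x) ` {s..}) = Z"
    and a: "a \<in> Z" "generic_specialization Q a"
  shows "(coxeter_mutation Q ^^ t) a \<in> Z"
proof (rule ccontr)
  let ?V = "verts Q" and ?\<mu> = "\<lambda>t. (coxeter_mutation Q ^^ t)"
  assume out: "?\<mu> t a \<notin> Z"
  have Z: "Z = zariski ?V closure_of ((\<lambda>t. ?\<mu> t x) ` {N..})" using stable[of N] by simp
  then have "closedin (zariski ?V) Z" by simp
  then obtain P where P: "P \<subseteq> polys ?V" "Z = zero_set ?V P" unfolding closedin_zariski by blast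
  have "?\<mu> t a \<in> affine_space ?V"
    using a(2) coxeter_iterate_affine by (auto simp: generic_specialization_def)
  then obtain p where p: "p \<in> P" "poly_eval p (?\<mu> t a) \<noteq> 0"
    using out unfolding P zero_set_def by blast
  have "regular_at ?V a (\<lambda>b. poly_eval p (?\<mu> t b))"
    using a(2) p P(1) by (intro regular_at_poly_eval regular_at_coxeter_iterate assms(1))
      (auto simp: generic_specialization_def)
  then obtain q where q: "q \<in> polys ?V" "poly_eval q a \<noteq> 0"
      "\<And>b. poly_eval q b \<noteq> 0 \<Longrightarrow> poly_eval p (?\<mu> t b) \<noteq> 0"
    using regular_at_nonzero_nearby p(2) by blast
  have "poly_eval q (?\<mu> s x) = 0" if "s \<ge> N" for s
  proof (rule ccontr)
    assume "poly_eval q (?\<mu> s x) \<noteq> 0"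
    then have "poly_eval p (?\<mu> (t + s) x) \<noteq> 0" using q(3) by (simp add: funpow_add)
    moreover have "(\<lambda>t. ?\<mu> t x) ` {N..} \<subseteq> Z"
      unfolding Z using coxeter_iterate_affine[OF x] by (intro closure_of_subset) auto
    then have "?\<mu> (t + s) x \<in> Z" using that by auto
    ultimately show False using p(1) by (simp add: P zero_set_def)
  qed
  then have "(\<lambda>t. ?\<mu> t x) ` {N..} \<subseteq> zero_set ?V {q}"
    using coxeter_iterate_affine[OF x] by (auto simp: zero_set_def)
  moreover have "closedin (zariski ?V) (zero_set ?V {q})"
    unfolding closedin_zariski using q(1) by blast
  ultimately have "Z \<subseteq> zero_set ?V {q}" unfolding Z by (rule closure_of_minimal)
  then show False using a(1) q(2) by (auto simp: zero_set_def)
qed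

text \<open>The hypothesis on \<open>Y\<close> says that the closure of the orbit of \<open>b\<close> contains \<open>Y\<close>. Monomials in \<open>M\<close> that
  form a basis of the functions on \<open>Y\<close> spanned by \<open>M\<close> are therefore independent along the orbit of \<open>b\<close>,
  and so along the orbits of nearby points \<open>a\<close>. For such \<open>a\<close> whose orbit lies in
  \<open>Y\<close>, the expansion in this basis of a polynomial vanishing on the orbit has only zero coefficients.\<close>

lemma nearby_orbits_separate_polys:
  fixes Q :: "(nat, 'e) pre_digraph"
  assumes "wf_digraph Q" and M: "finite M" "\<And>m. m \<in> M \<Longrightarrow> Poly_Mapping.keys m \<subseteq> verts Q"
    and b: "generic_specialization Q b"
    and Y: "\<And>p. p \<in> polys (verts Q) \<Longrightarrow> (\<And>t. poly_eval p ((coxeter_mutation Q ^^ t) b) = 0) \<Longrightarrow>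
      (\<And>y. y \<in> Y \<Longrightarrow> poly_eval p y = 0)"
  obtains q where "q \<in> polys (verts Q)" "poly_eval q b \<noteq> 0"
    "\<And>a p y. poly_eval q a \<noteq> 0 \<Longrightarrow> Poly_Mapping.keys p \<subseteq> M \<Longrightarrow>
       (\<And>t. (coxeter_mutation Q ^^ t) a \<in> Y) \<Longrightarrow>
       (\<And>t. poly_eval p ((coxeter_mutation Q ^^ t) a) = 0) \<Longrightarrow> y \<in> Y \<Longrightarrow> poly_eval p y = 0"
proof -
  let ?V = "verts Q" and ?\<mu> = "\<lambda>t. (coxeter_mutation Q ^^ t)"
  obtain B where B: "B \<subseteq> M" "lin_indep B Y mon_eval"
    "\<And>c. \<exists>d. \<forall>y\<in>Y. (\<Sum>m\<in>M. c m * mon_eval m y) = (\<Sum>m\<in>B. d m * mon_eval m y)"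
    using lin_indep_spanning_subset[OF M(1)] by blast
  have finB: "finite B" using B(1) M(1) finite_subset by blast
  have "lin_indep B UNIV (\<lambda>m t. mon_eval m (?\<mu> t b))"
    unfolding lin_indep_def
  proof (intro allI impI)
    fix c assume c: "\<forall>t\<in>UNIV. (\<Sum>m\<in>B. c m * mon_eval m (?\<mu> t b)) = 0"
    let ?p = "\<Sum>m\<in>B. Poly_Mapping.single m (c m)"
    have ev: "poly_eval ?p a = (\<Sum>m\<in>B. c m * mon_eval m a)" for a by (simp add: poly_eval_sum)
    have "?p \<in> polys ?V" using B(1) M(2) by (intro polys_sum polys_single) auto
    then have "\<forall>y\<in>Y. (\<Sum>m\<in>B. c m * mon_eval m y) = 0" using Y[of ?p] c by (simp add: ev)
    then show "\<forall>m\<in>B. c m = 0" using B(2) unfolding lin_indep_def by blast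
  qed
  moreover have "regular_at ?V b (\<lambda>a. mon_eval m (?\<mu> t a))" if "m \<in> B" for m t
    using b that B(1) M(2) by (intro regular_at_mon_eval regular_at_coxeter_iterate assms(1))
      (auto simp: generic_specialization_def)
  ultimately have "\<exists>q\<in>polys ?V. poly_eval q b \<noteq> 0 \<and>
      (\<forall>a. poly_eval q a \<noteq> 0 \<longrightarrow> lin_indep B UNIV (\<lambda>m t. mon_eval m (?\<mu> t a)))"
    by (intro lin_indep_nearby[OF finB])
  then obtain q where q: "q \<in> polys ?V" "poly_eval q b \<noteq> 0"
      "\<And>a. poly_eval q a \<noteq> 0 \<Longrightarrow> lin_indep B UNIV (\<lambda>m t. mon_eval m (?\<mu> t a))"
    by blast
  show thesis
  proof (rule that[OF q(1,2)])
    fix a p y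
    assume a: "poly_eval q a \<noteq> 0" and p: "Poly_Mapping.keys p \<subseteq> M" and inY: "\<And>t. ?\<mu> t a \<in> Y"
      and zero: "\<And>t. poly_eval p (?\<mu> t a) = 0" and y: "y \<in> Y"
    obtain d where d: "\<And>y. y \<in> Y \<Longrightarrow> poly_eval p y = (\<Sum>m\<in>B. d m * mon_eval m y)"
      using B(3)[of "Poly_Mapping.lookup p"] unfolding poly_eval_superset[OF M(1) p] by blast
    have "(\<Sum>m\<in>B. d m * mon_eval m (?\<mu> t a)) = 0" for t using d[OF inY] zero by simp
    then have "\<forall>m\<in>B. d m = 0" using q(3)[OF a] unfolding lin_indep_def by blast
    then show "poly_eval p y = 0" using d[OF y] by simp
  qed
qed

section \<open>Generic points of the frieze variety\<close>

theorem theorem2p3: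
  fixes Q :: "(nat, 'e) pre_digraph" and n :: nat
  assumes "fin_digraph Q"
    and "verts Q = {1..n}"
    and "Digraph_Component.connected Q"
    and "acyclic (arcs_ends Q)"
    and "\<forall>e\<in>arcs Q. tail Q e > head Q e"
  shows "\<forall>C \<in> irreducible_components (subtopology (zariski {1..n}) (frieze_variety Q)).
    krull_dim (subtopology (zariski {1..n}) C) \<ge> 1 \<longrightarrow>
    (\<exists>(U :: (nat \<Rightarrow> complex) set) (Ud :: nat \<Rightarrow> (nat \<Rightarrow> complex) set).
       U \<subseteq> C \<and> U = (\<Inter>d\<in>{1..}. Ud d) \<and>
       (\<forall>d\<ge>1. dense_open_in (subtopology (zariski {1..n}) C) (Ud d)) \<and>
       (\<forall>a\<in>U. generic_specialization Q a \<and> gen_frieze_variety Q a = frieze_variety_tilde Q))"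
proof (intro ballI impI)
  let ?V = "{1..n}" and ?\<mu> = "\<lambda>t. (coxeter_mutation Q ^^ t)"
  let ?T = "zariski ?V"
  define X where "X = frieze_variety Q"
  fix C assume C: "C \<in> irreducible_components (subtopology ?T (frieze_variety Q))"
    and dim: "krull_dim (subtopology ?T C) \<ge> 1"
  note V = assms(2)
  have wf: "wf_digraph Q" using assms(1) by (simp add: fin_digraph_def)
  have noeth: "noetherian_space ?T" by (rule noetherian_zariski) simp
  define x where "x t = ?\<mu> t (ones Q)" for t
  have x_aff: "x t \<in> affine_space ?V" for t
    using coxeter_iterate_affine[of "ones Q" Q t] by (simp add: x_def V)
  have x_add: "?\<mu> t (x s) = x (t + s)" for t s by (simp add: x_def funpow_add)
  have x_generic: "generic_specialization Q (x s)" for s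
    using frieze_orbit_nonzero[OF wf] x_aff
    unfolding generic_specialization_def x_add V[symmetric] unfolding x_def by blast
  have X: "X = ?T closure_of (range x)"
    unfolding X_def frieze_variety_def gen_frieze_variety_def coxeter_orbit_def V x_def
    by (simp add: full_SetCompr_eq)
  have closedX: "closedin ?T X" unfolding X by simp
  have T1: "closedin ?T {p}" if "p \<in> topspace ?T" for p
    using that closedin_zariski_singleton by simp
  have comp: "irreducible_in ?T D" "D \<subseteq> X" "closedin ?T D"
      "krull_dim (subtopology ?T D) = 0 \<longleftrightarrow> (\<exists>p. D = {p})"
    if "D \<in> irreducible_components (subtopology ?T X)" for D
  proof -
    show *: "irreducible_in ?T D" "D \<subseteq> X" "closedin ?T D"
      using that component_closed[OF noeth closedX] by (auto simp: irreducible_components_subtopology)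
    show "krull_dim (subtopology ?T D) = 0 \<longleftrightarrow> (\<exists>p. D = {p})"
      by (rule krull_dim_eq_0_iff[OF *(1,3)]) (use T1 closedin_subset[OF *(3)] in blast)
  qed
  note C = C[folded X_def]
  have Cpt: "C \<noteq> {p}" for p using comp(4)[OF C] dim by auto
  \<comment> \<open>a repetition makes the orbit finite, and an irreducible set of finitely many closed points is a point\<close>
  have inj: "inj x"
  proof (rule ccontr)
    assume "\<not> inj x"
    then obtain s t where "x s = x t" "s < t" by (metis injI linorder_neqE_nat)
    then have fin: "finite (range x)" unfolding x_def[abs_def] by (rule funpow_range_finite)
    then have "closedin ?T (\<Union>p\<in>range x. {p})"
      using T1 x_aff by (intro closedin_Union) auto
    then have "X = range x" unfolding X by (simp add: closure_of_closedin)
    then have "C \<subseteq> \<Union>((\<lambda>p. {p}) ` range x)" using comp(2)[OF C] by auto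
    then obtain A where "A \<in> (\<lambda>p. {p}) ` range x" "C \<subseteq> A"
    proof (rule irreducible_in_subset_Union[OF comp(1)[OF C], rotated 2])
      show "finite ((\<lambda>p. {p}) ` range x)" using fin by blast
      show "closedin ?T A" if "A \<in> (\<lambda>p. {p}) ` range x" for A using that T1 x_aff by auto
    qed
    then obtain p where "C \<subseteq> {p}" by blast
    then show False using Cpt irreducible_in_nonempty[OF comp(1)[OF C]] by blast
  qed
  obtain N where N: "\<And>s. s \<ge> N \<Longrightarrow> ?T closure_of (x ` {s..}) = ?T closure_of (x ` {N..})"
    using tail_closure_stabilizes[OF noeth] by blast
  define Z where "Z = ?T closure_of (x ` {N..})"
  have tail: "?T closure_of (x ` {s..}) = Z" if "s \<ge> N" for s using N[OF that] by (simp add: Z_def)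
  have Z: "X - \<Union>{D \<in> irreducible_components (subtopology ?T X). \<exists>p. D = {p}} = Z"
    unfolding X Z_def using T1 _ inj N by (rule tail_closure_eq_nonpoint_components[OF noeth]) (use x_aff in auto)
  have tilde: "frieze_variety_tilde Q = Z"
    unfolding frieze_variety_tilde_def remove_zero_dim_components_def X_def[symmetric] V Z[symmetric]
    using comp(4) by blast
  have CZ: "C \<subseteq> Z"
  proof
    fix p assume p: "p \<in> C"
    have "{p} \<notin> irreducible_components (subtopology ?T X)"
      using comp[OF C] p Cpt by (auto simp: irreducible_components_subtopology)
    then show "p \<in> Z" using p comp(2)[OF C] unfolding Z[symmetric] by blast
  qed
  have ZX: "Z \<subseteq> X" unfolding Z[symmetric] by blast
  have "x ` {N..} \<subseteq> topspace ?T" using x_aff by auto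
  then have "C \<inter> x ` {N..} \<noteq> {}"
    using component_meets_dense[OF noeth C, of "x ` {N..}"] CZ ZX unfolding Z_def by blast
  then obtain s where s: "s \<ge> N" "x s \<in> C" by auto
  \<comment> \<open>the orbit of \<open>x s\<close> is a tail, whose closure is \<open>Z\<close>\<close>
  have on_Z: "poly_eval p y = 0"
    if "p \<in> polys ?V" "\<And>t. poly_eval p (?\<mu> t (x s)) = 0" "y \<in> Z" for p y
  proof -
    have "poly_eval p (x r) = 0" if "r \<ge> s" for r
      using \<open>\<And>t. poly_eval p (?\<mu> t (x s)) = 0\<close>[of "r - s"] that by (simp add: x_add)
    then have "x ` {s..} \<subseteq> zero_set ?V {p}" using x_aff by (auto simp: zero_set_def)
    moreover have "closedin ?T (zero_set ?V {p})" unfolding closedin_zariski using that(1) by blast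
    ultimately have "Z \<subseteq> zero_set ?V {p}" unfolding tail[OF s(1), symmetric] by (rule closure_of_minimal)
    then show ?thesis using that(3) by (auto simp: zero_set_def)
  qed
  have "\<exists>q. q \<in> polys ?V \<and> poly_eval q (x s) \<noteq> 0 \<and>
      (\<forall>a. poly_eval q a \<noteq> 0 \<longrightarrow> (\<forall>k\<in>?V. ?\<mu> t a k \<noteq> 0))" for t
  proof -
    let ?g = "\<lambda>a. \<Prod>k\<in>?V. ?\<mu> t a k"
    have "regular_at ?V (x s) ?g"
      using x_generic[of s] unfolding V[symmetric]
      by (intro regular_at_prod regular_at_coxeter_iterate wf) (auto simp: generic_specialization_def)
    moreover have "?g (x s) \<noteq> 0" using x_generic[of s] by (simp add: generic_specialization_def V)
    ultimately obtain q where "q \<in> polys ?V" "poly_eval q (x s) \<noteq> 0"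
        "\<And>a. poly_eval q a \<noteq> 0 \<Longrightarrow> ?g a \<noteq> 0"
      using regular_at_nonzero_nearby by blast
    then show ?thesis by auto
  qed
  then obtain q where q: "\<And>t. q t \<in> polys ?V" "\<And>t. poly_eval (q t) (x s) \<noteq> 0"
      "\<And>t a k. poly_eval (q t) a \<noteq> 0 \<Longrightarrow> k \<in> ?V \<Longrightarrow> ?\<mu> t a k \<noteq> 0" by metis
  have "\<exists>r. r \<in> polys ?V \<and> poly_eval r (x s) \<noteq> 0 \<and>
      (\<forall>a p y. poly_eval r a \<noteq> 0 \<longrightarrow> Poly_Mapping.keys p \<subseteq> bounded_mons ?V d \<longrightarrow>
        (\<forall>t. ?\<mu> t a \<in> Z) \<longrightarrow> (\<forall>t. poly_eval p (?\<mu> t a) = 0) \<longrightarrow> y \<in> Z \<longrightarrow> poly_eval p y = 0)" for d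
  proof -
    show ?thesis
    proof (rule nearby_orbits_separate_polys[OF wf, unfolded V, where M = "bounded_mons ?V d" and b = "x s" and Y = Z])
      show "finite (bounded_mons ?V d)" by (simp add: finite_bounded_mons)
      show "Poly_Mapping.keys m \<subseteq> ?V" if "m \<in> bounded_mons ?V d" for m
        using that by (simp add: bounded_mons_def)
      show "generic_specialization Q (x s)" by (rule x_generic)
      show "poly_eval p y = 0"
        if "p \<in> polys ?V" "\<And>t. poly_eval p (?\<mu> t (x s)) = 0" "y \<in> Z" for p y
        by (rule on_Z[OF that])
    next
      fix q assume "q \<in> polys ?V" "poly_eval q (x s) \<noteq> 0"
        "\<And>a p y. poly_eval q a \<noteq> 0 \<Longrightarrow> Poly_Mapping.keys p \<subseteq> bounded_mons ?V d \<Longrightarrow>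
          (\<And>t. ?\<mu> t a \<in> Z) \<Longrightarrow> (\<And>t. poly_eval p (?\<mu> t a) = 0) \<Longrightarrow> y \<in> Z \<Longrightarrow> poly_eval p y = 0"
      then show ?thesis by (intro exI[of _ q]) simp
    qed
  qed
  then obtain r where r: "\<And>d. r d \<in> polys ?V" "\<And>d. poly_eval (r d) (x s) \<noteq> 0"
      "\<And>d a p y. poly_eval (r d) a \<noteq> 0 \<Longrightarrow> Poly_Mapping.keys p \<subseteq> bounded_mons ?V d \<Longrightarrow>
        (\<forall>t. ?\<mu> t a \<in> Z) \<Longrightarrow> (\<forall>t. poly_eval p (?\<mu> t a) = 0) \<Longrightarrow> y \<in> Z \<Longrightarrow> poly_eval p y = 0"
    by metis
  \<comment> \<open>the shift makes \<open>d \<ge> 1\<close> run through the conditions on all iterates, including the zeroth\<close>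
  define Ud where "Ud d = {a \<in> C. poly_eval (q (d - 1) * r d) a \<noteq> 0}" for d
  have dense: "dense_open_in (subtopology ?T C) (Ud d)" for d
    unfolding Ud_def using comp(1)[OF C] q(1,2) r(1,2) s(2)
    by (intro nonzero_locus_dense_open[of _ _ _ "x s"]) (auto simp: poly_eval_mult intro: polys_mult)
  have sub: "(\<Inter>d\<in>{1..}. Ud d) \<subseteq> C" by (auto simp: Ud_def)
  have good: "generic_specialization Q a \<and> gen_frieze_variety Q a = frieze_variety_tilde Q"
    if a: "a \<in> (\<Inter>d\<in>{1..}. Ud d)" for a
  proof
    have aC: "a \<in> C" and ar: "\<And>d. d \<ge> 1 \<Longrightarrow> poly_eval (r d) a \<noteq> 0"
      using a by (auto simp: Ud_def poly_eval_mult)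
    have aq: "poly_eval (q t) a \<noteq> 0" for t
      using INT_D[OF a, of "Suc t"] by (simp add: Ud_def poly_eval_mult)
    have "a \<in> affine_space ?V" using aC closedin_subset[OF comp(3)[OF C]] by auto
    then show gen: "generic_specialization Q a"
      using q(3)[OF aq] by (simp add: generic_specialization_def V)
    have orbit_Z: "?\<mu> t a \<in> Z" for t
    proof (rule coxeter_iterate_tail_closure[OF wf _ _ _ gen])
      show "ones Q \<in> affine_space (verts Q)" by simp
      show "zariski (verts Q) closure_of ((\<lambda>t. ?\<mu> t (ones Q)) ` {s..}) = Z" if "s \<ge> N" for s
        using tail[OF that] by (simp add: V x_def[abs_def])
    qed (use aC CZ in blast)
    have orbit: "coxeter_orbit Q a = range (\<lambda>t. ?\<mu> t a)"
      by (simp add: coxeter_orbit_def full_SetCompr_eq)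
    have "?T closure_of coxeter_orbit Q a \<subseteq> Z"
      using orbit_Z by (intro closure_of_minimal) (auto simp: orbit Z_def)
    moreover have "Z \<subseteq> ?T closure_of coxeter_orbit Q a"
    proof -
      obtain P where P: "P \<subseteq> polys ?V" "?T closure_of coxeter_orbit Q a = zero_set ?V P"
        using closedin_closure_of[of ?T "coxeter_orbit Q a"] unfolding closedin_zariski by blast
      have "coxeter_orbit Q a \<subseteq> zero_set ?V P"
        unfolding P(2)[symmetric] using orbit_Z closure_of_subset_topspace[of ?T]
        by (intro closure_of_subset) (auto simp: orbit Z_def)
      then have zero: "poly_eval p (?\<mu> t a) = 0" if "p \<in> P" for p t
        using that by (auto simp: orbit zero_set_def)
      have "poly_eval p y = 0" if p: "p \<in> P" and y: "y \<in> Z" for p y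
      proof -
        obtain d where d: "d \<ge> 1" "Poly_Mapping.keys p \<subseteq> bounded_mons ?V d"
          using poly_bounded_mons p P(1) by blast
        then show ?thesis using r(3)[OF ar[OF d(1)] d(2)] orbit_Z zero[OF p] y by blast
      qed
      moreover have "Z \<subseteq> affine_space ?V" using closure_of_subset_topspace[of ?T] by (auto simp: Z_def)
      ultimately show ?thesis unfolding P(2) by (auto simp: zero_set_def)
    qed
    ultimately show "gen_frieze_variety Q a = frieze_variety_tilde Q"
      unfolding tilde gen_frieze_variety_def V by blast
  qed
  show "\<exists>U (Ud :: nat \<Rightarrow> (nat \<Rightarrow> complex) set). U \<subseteq> C \<and> U = (\<Inter>d\<in>{1..}. Ud d) \<and>
       (\<forall>d\<ge>1. dense_open_in (subtopology ?T C) (Ud d)) \<and>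
       (\<forall>a\<in>U. generic_specialization Q a \<and> gen_frieze_variety Q a = frieze_variety_tilde Q)"
    using dense sub good by (intro exI[of _ "\<Inter>d\<in>{1..}. Ud d"] exI[of _ Ud]) blast
qed

end
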